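(* Let $m$ be a positive integer with $m>\lceil d_\epsilon\rceil+\lceil\tilde d_{\tilde\epsilon}\rceil$, and put $$Q_{m+1}(\xi):=\sum_{0\leq k\leq 2(\tilde d_{\tilde\epsilon}+1)}\mathrm e_k(\tilde\alpha;1-\tilde\epsilon_+;1-\tilde\epsilon_-)\,\mathtt q_{m+1-k}(\xi).$$ Then $Q_{m+1}(\xi)$ is a polynomial of degree $m+1$ in $\cos(\xi)$ that factorizes as $$Q_{m+1}(\xi)=2^{m+1}\bigl(\cos(\xi)-\cos(\xi^{(m)}_0)\bigr)\cdots\bigl(\cos(\xi)-\cos(\xi^{(m)}_m)\bigr),$$ and it coincides with the characteristic polynomials of the matrices $L^{(m)}$ and $J^{(m)}$: $$\det\bigl(2\cos(\xi)I^{(m)}-L^{(m)}\bigr)=\det\bigl(2\cos(\xi)I^{(m)}-J^{(m)}\bigr)=Q_{m+1}(\xi),$$ where $I^{(m)}$ is the $(m+1)$-dimensional identity matrix.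
   Context: **Parameters.** Fix nonnegative integers $d,\tilde d$, signs $\epsilon_\pm,\tilde\epsilon_\pm\in\{0,1\}$, and parameters $\alpha_1,\ldots,\alpha_d$ and $\tilde\alpha_1,\ldots,\tilde\alpha_{\tilde d}$ with $0<|\alpha_r|<1$, $0<|\tilde\alpha_r|<1$, where possible complex parameters among the $\alpha_r$ occur in complex conjugate pairs, and likewise for the $\tilde\alpha_r$. Put $d_\epsilon:=\frac12(d-\epsilon_+-\epsilon_-)$ and $\tilde d_{\tilde\epsilon}:=\frac12(\tilde d-\tilde\epsilon_+-\tilde\epsilon_-)$. **Bernstein-Szegö polynomials.** Let $$c(\xi):=(1+\epsilon_+e^{-i\xi})^{-1}(1-\epsilon_-e^{-i\xi})^{-1}\prod_{1\leq r\leq d}(1+\alpha_re^{-i\xi}),\qquad w(\xi):=\frac{1}{2\pi|c(\xi)|^2}\quad(0<\xi<\pi).$$ Let $p_l(\xi)$, $l=0,1,2,\ldots$, be the polynomials of degree $l$ in $\cos\xi$ obtained by Gram-Schmidt orthogonalization of $1,\ e^{i\xi}+e^{-i\xi},\ e^{2i\xi}+e^{-2i\xi},\ldots$ in $L^2((0,\pi),w(\xi)d\xi)$, normalized so that their expansion in these functions is unitriangular (leading coefficient 1). Put $\Delta_l:=\int_0^\pi p_l^2(\xi)w(\xi)\,d\xi$ and $\mathtt p_l(\xi):=\Delta_l^{-1}p_l(\xi)$. These satisfy a three-term recurrence $$2\cos(\xi)\mathtt p_l(\xi)=\mathtt p_{l-1}(\xi)+b_l\mathtt p_l(\xi)+a_{l+1}^2\mathtt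 p_{l+1}(\xi),\qquad a_{l+1}:=(\Delta_{l+1}/\Delta_l)^{1/2},\quad \mathtt p_{-1}:=0,$$ which defines the real coefficients $b_l$ ($l\geq0$). The objects $\tilde\Delta_l$, $\tilde a_{l+1}$, $\tilde b_l$ are defined in the same way from $\tilde d,\tilde\epsilon_\pm,\tilde\alpha_r$. **Ingredients of $Q_{m+1}$.** For $l\in\mathbb Z$, $\mathtt q_l(\xi):=c(\xi)e^{il\xi}+c(-\xi)e^{-il\xi}$ (with removable singularities at poles of $c(\pm\xi)$ removed). For $\eta_\pm\in\{0,1\}$, $$\mathrm e_k(\tilde\alpha;\eta_+;\eta_-):=\mathrm e_k(\tilde\alpha)+(\eta_+-\eta_-)\mathrm e_{k-1}(\tilde\alpha)-\eta_+\eta_-\mathrm e_{k-2}(\tilde\alpha),$$ where $\mathrm e_k(\tilde\alpha):=\sum_{1\leq r_1<\cdots<r_k\leq\tilde d}\tilde\alpha_{r_1}\cdots\tilde\alpha_{r_k}$ is the elementary symmetric polynomial, with $\mathrm e_0(\tilde\alpha):=1$ and $\mathrm e_k(\tilde\alpha):=0$ if $k\notin\{0,1,\ldots,\tilde d\}$. **Nodes.** For $|\alpha|<1$ let $u_\alpha(x):=\frac{1-\alpha^2}{1+2\alpha\cos(x)+\alpha^2}$. For $\hat l\in\{0,\ldots,m\}$, $\xi^{(m)}_{\hat l}$ denotes the unique real solution $\xi$ of $$2(m-d_\epsilon-\tilde d_{\tilde\epsilon})\xi+\sum_{1\leq r\leq d}\int_0^\xi u_{\alpha_r}(x)dx+\sum_{1\leq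 r\leq\tilde d}\int_0^\xi u_{\tilde\alpha_r}(x)dx=\pi(2\hat l+\epsilon_-+\tilde\epsilon_-).$$ One has $0\leq\xi^{(m)}_0<\cdots<\xi^{(m)}_m\leq\pi$. **The matrices.** $L^{(m)}=[L^{(m)}_{l,k}]_{0\leq l,k\leq m}$ is the tridiagonal matrix with $$L^{(m)}_{l,k}:=\begin{cases}\delta_{l-k-1}+b_l\delta_{l-k}+a_{l+1}^2\delta_{l-k+1}&\text{if }0\leq l\leq\lceil d_\epsilon\rceil,\\ \delta_{l-k-1}+\delta_{l-k+1}&\text{if }\lceil d_\epsilon\rceil<l<m-\lceil\tilde d_{\tilde\epsilon}\rceil,\\ \tilde a_{m-l+1}^2\delta_{l-k-1}+\tilde b_{m-l}\delta_{l-k}+\delta_{l-k+1}&\text{if }m-\lceil\tilde d_{\tilde\epsilon}\rceil\leq l\leq m,\end{cases}$$ where $\delta_x:=1$ if $x=0$ and $\delta_x:=0$ otherwise; and $J^{(m)}:=(\Delta^{(m)})^{1/2}L^{(m)}(\Delta^{(m)})^{-1/2}$, where $\Delta^{(m)}:=\mathrm{diag}(\Delta^{(m)}_0,\ldots,\Delta^{(m)}_m)$ with $\Delta^{(m)}_l:=\Delta_l$ if $0\leq l\leq d_\epsilon$, $\Delta^{(m)}_l:=1$ if $d_\epsilon<l<m-\tilde d_{\tilde\epsilon}$, and $\Delta^{(m)}_l:=\tilde\Delta_{m-l}$ if $m-\tilde d_{\tilde\epsilon}\leq l\leq m$. *)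

theory Defs
  imports "HOL-Complex_Analysis.Complex_Analysis" "Jordan_Normal_Form.Determinant"
begin

text \<open>
  A family of parameters is given by \<open>d\<close>, the signs \<open>ep\<close>, \<open>em\<close> (in \<open>{0, 1}\<close>) and
  \<open>\<alpha> 1, \<dots>, \<alpha> d\<close>; the values of \<open>\<alpha>\<close> outside \<open>{1..d}\<close> are never used.
  Every notion attached to one family takes it as the arguments \<open>d ep em \<alpha>\<close>.
\<close>

definition conj_paired :: "nat \<Rightarrow> (nat \<Rightarrow> complex) \<Rightarrow> bool" where
  "conj_paired d \<alpha> \<longleftrightarrow>
     (\<forall>z. z \<notin> \<real> \<longrightarrow> card {r \<in> {1..d}. \<alpha> r = z} = card {r \<in> {1..d}. \<alpha> r = cnj z})"

definition admissible :: "nat \<Rightarrow> nat \<Rightarrow> nat \<Rightarrow> (nat \<Rightarrow> complex) \<Rightarrow> bool" where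
  "admissible d ep em \<alpha> \<longleftrightarrow>
     ep \<in> {0, 1} \<and> em \<in> {0, 1} \<and>
     (\<forall>r\<in>{1..d}. 0 < cmod (\<alpha> r) \<and> cmod (\<alpha> r) < 1) \<and> conj_paired d \<alpha>"

definition d_eps :: "nat \<Rightarrow> nat \<Rightarrow> nat \<Rightarrow> real" where
  "d_eps d ep em = (real d - real ep - real em) / 2"


subsection \<open>Bernstein-Szegoe polynomials\<close>

text \<open>The spectral variable of \<open>c\<close> is complex; the weight only uses real arguments.\<close>

definition bs_c :: "nat \<Rightarrow> nat \<Rightarrow> nat \<Rightarrow> (nat \<Rightarrow> complex) \<Rightarrow> complex \<Rightarrow> complex" where
  "bs_c d ep em \<alpha> \<xi> =
     inverse (1 + of_nat ep * exp (- \<i> * \<xi>)) * inverse (1 - of_nat em * exp (- \<i> * \<xi>)) *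
     (\<Prod>r = 1..d. 1 + \<alpha> r * exp (- \<i> * \<xi>))"

definition bs_w :: "nat \<Rightarrow> nat \<Rightarrow> nat \<Rightarrow> (nat \<Rightarrow> complex) \<Rightarrow> real \<Rightarrow> real" where
  "bs_w d ep em \<alpha> \<xi> = 1 / (2 * pi * (cmod (bs_c d ep em \<alpha> (of_real \<xi>)))\<^sup>2)"

definition bs_ip ::
    "nat \<Rightarrow> nat \<Rightarrow> nat \<Rightarrow> (nat \<Rightarrow> complex) \<Rightarrow> (real \<Rightarrow> real) \<Rightarrow> (real \<Rightarrow> real) \<Rightarrow> real" where
  "bs_ip d ep em \<alpha> f g = (LINT \<xi>:{0<..<pi}|lborel. f \<xi> * g \<xi> * bs_w d ep em \<alpha> \<xi>)"

text \<open>The functions \<open>1\<close> and \<open>e\<^sup>i\<^sup>l\<^sup>\<xi> + e\<^sup>-\<^sup>i\<^sup>l\<^sup>\<xi>\<close> (\<open>l \<ge> 1\<close>), written as real functions.\<close>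

definition cos_mono :: "nat \<Rightarrow> real \<Rightarrow> real" where
  "cos_mono l \<xi> = (if l = 0 then 1 else 2 * cos (real l * \<xi>))"

fun gs_orth ::
    "((real \<Rightarrow> real) \<Rightarrow> (real \<Rightarrow> real) \<Rightarrow> real) \<Rightarrow> (nat \<Rightarrow> real \<Rightarrow> real) \<Rightarrow> nat \<Rightarrow> real \<Rightarrow> real" where
  "gs_orth ip f l =
     (\<lambda>\<xi>. f l \<xi> -
        (\<Sum>k<l. ip (f l) (gs_orth ip f k) / ip (gs_orth ip f k) (gs_orth ip f k) *
               gs_orth ip f k \<xi>))"

declare gs_orth.simps [simp del]

definition bs_p :: "nat \<Rightarrow> nat \<Rightarrow> nat \<Rightarrow> (nat \<Rightarrow> complex) \<Rightarrow> nat \<Rightarrow> real \<Rightarrow> real" where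
  "bs_p d ep em \<alpha> = gs_orth (bs_ip d ep em \<alpha>) cos_mono"

definition bs_Delta :: "nat \<Rightarrow> nat \<Rightarrow> nat \<Rightarrow> (nat \<Rightarrow> complex) \<Rightarrow> nat \<Rightarrow> real" where
  "bs_Delta d ep em \<alpha> l = (LINT \<xi>:{0<..<pi}|lborel. (bs_p d ep em \<alpha> l \<xi>)\<^sup>2 * bs_w d ep em \<alpha> \<xi>)"

definition bs_pn :: "nat \<Rightarrow> nat \<Rightarrow> nat \<Rightarrow> (nat \<Rightarrow> complex) \<Rightarrow> nat \<Rightarrow> real \<Rightarrow> real" where
  "bs_pn d ep em \<alpha> l \<xi> = bs_p d ep em \<alpha> l \<xi> / bs_Delta d ep em \<alpha> l"

text \<open>Only meaningful for \<open>l \<ge> 1\<close>; the index \<open>0\<close> never contributes.\<close>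

definition bs_a :: "nat \<Rightarrow> nat \<Rightarrow> nat \<Rightarrow> (nat \<Rightarrow> complex) \<Rightarrow> nat \<Rightarrow> real" where
  "bs_a d ep em \<alpha> l = sqrt (bs_Delta d ep em \<alpha> l / bs_Delta d ep em \<alpha> (l - 1))"

definition bs_b :: "nat \<Rightarrow> nat \<Rightarrow> nat \<Rightarrow> (nat \<Rightarrow> complex) \<Rightarrow> nat \<Rightarrow> real" where
  "bs_b d ep em \<alpha> l =
     (THE b. \<forall>\<xi>. 2 * cos \<xi> * bs_pn d ep em \<alpha> l \<xi> =
        (if l = 0 then 0 else bs_pn d ep em \<alpha> (l - 1) \<xi>) + b * bs_pn d ep em \<alpha> l \<xi> +
        (bs_a d ep em \<alpha> (l + 1))\<^sup>2 * bs_pn d ep em \<alpha> (l + 1) \<xi>)"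


subsection \<open>The function \<open>Q\<close>\<close>

definition bs_q :: "nat \<Rightarrow> nat \<Rightarrow> nat \<Rightarrow> (nat \<Rightarrow> complex) \<Rightarrow> int \<Rightarrow> complex \<Rightarrow> complex" where
  "bs_q d ep em \<alpha> l =
     remove_sings (\<lambda>\<xi>. bs_c d ep em \<alpha> \<xi> * exp (\<i> * of_int l * \<xi>) +
                        bs_c d ep em \<alpha> (- \<xi>) * exp (- \<i> * of_int l * \<xi>))"

definition elem_sym :: "nat \<Rightarrow> (nat \<Rightarrow> complex) \<Rightarrow> int \<Rightarrow> complex" where
  "elem_sym d \<alpha> k =
     (if k < 0 then 0 else (\<Sum>S | S \<subseteq> {1..d} \<and> card S = nat k. \<Prod>r\<in>S. \<alpha> r))"

definition elem_sym_eta :: "nat \<Rightarrow> (nat \<Rightarrow> complex) \<Rightarrow> nat \<Rightarrow> nat \<Rightarrow> int \<Rightarrow> complex" where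
  "elem_sym_eta d \<alpha> hp hm k =
     elem_sym d \<alpha> k + (of_nat hp - of_nat hm) * elem_sym d \<alpha> (k - 1)
       - of_nat hp * of_nat hm * elem_sym d \<alpha> (k - 2)"

text \<open>
  In the following definitions the second family \<open>d' ep' em' \<alpha>'\<close> carries the tildes.
  The value \<open>bs_Q \<dots> m\<close> is the function with index \<open>m + 1\<close>.
\<close>

definition bs_Q ::
    "nat \<Rightarrow> nat \<Rightarrow> nat \<Rightarrow> (nat \<Rightarrow> complex) \<Rightarrow> nat \<Rightarrow> nat \<Rightarrow> nat \<Rightarrow> (nat \<Rightarrow> complex) \<Rightarrow>
     nat \<Rightarrow> complex \<Rightarrow> complex" where
  "bs_Q d ep em \<alpha> d' ep' em' \<alpha>' m \<xi> =
     (\<Sum>k | real k \<le> 2 * (d_eps d' ep' em' + 1).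
        elem_sym_eta d' \<alpha>' (1 - ep') (1 - em') (int k) *
        bs_q d ep em \<alpha> (int m + 1 - int k) \<xi>)"


subsection \<open>Nodes\<close>

definition poisson_u :: "complex \<Rightarrow> real \<Rightarrow> complex" where
  "poisson_u \<alpha> x = (1 - \<alpha>\<^sup>2) / (1 + 2 * \<alpha> * of_real (cos x) + \<alpha>\<^sup>2)"

text \<open>
  For non-real parameters the single integrals are complex, so the equation is stated in
  the complex numbers. The integrals are oriented, i.e. they change sign for \<open>\<xi> < 0\<close>.
\<close>

definition bs_node ::
    "nat \<Rightarrow> nat \<Rightarrow> nat \<Rightarrow> (nat \<Rightarrow> complex) \<Rightarrow> nat \<Rightarrow> nat \<Rightarrow> nat \<Rightarrow> (nat \<Rightarrow> complex) \<Rightarrow>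
     nat \<Rightarrow> nat \<Rightarrow> real" where
  "bs_node d ep em \<alpha> d' ep' em' \<alpha>' m j =
     (THE \<xi>::real.
        complex_of_real (2 * (real m - d_eps d ep em - d_eps d' ep' em') * \<xi>)
        + (\<Sum>r = 1..d. LBINT x=0..ereal \<xi>. poisson_u (\<alpha> r) x)
        + (\<Sum>r = 1..d'. LBINT x=0..ereal \<xi>. poisson_u (\<alpha>' r) x)
        = complex_of_real (pi * (2 * real j + real em + real em')))"


subsection \<open>The matrices\<close>

definition kdelta :: "int \<Rightarrow> real" where
  "kdelta x = (if x = 0 then 1 else 0)"

definition bs_L ::
    "nat \<Rightarrow> nat \<Rightarrow> nat \<Rightarrow> (nat \<Rightarrow> complex) \<Rightarrow> nat \<Rightarrow> nat \<Rightarrow> nat \<Rightarrow> (nat \<Rightarrow> complex) \<Rightarrow>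
     nat \<Rightarrow> real Matrix.mat" where
  "bs_L d ep em \<alpha> d' ep' em' \<alpha>' m =
     Matrix.mat (m + 1) (m + 1) (\<lambda>(l, k).
       if int l \<le> \<lceil>d_eps d ep em\<rceil> then
         kdelta (int l - int k - 1) + bs_b d ep em \<alpha> l * kdelta (int l - int k)
           + (bs_a d ep em \<alpha> (l + 1))\<^sup>2 * kdelta (int l - int k + 1)
       else if int l < int m - \<lceil>d_eps d' ep' em'\<rceil> then
         kdelta (int l - int k - 1) + kdelta (int l - int k + 1)
       else
         (bs_a d' ep' em' \<alpha>' (m - l + 1))\<^sup>2 * kdelta (int l - int k - 1)
           + bs_b d' ep' em' \<alpha>' (m - l) * kdelta (int l - int k)
           + kdelta (int l - int k + 1))"

definition bs_Delta_m ::
    "nat \<Rightarrow> nat \<Rightarrow> nat \<Rightarrow> (nat \<Rightarrow> complex) \<Rightarrow> nat \<Rightarrow> nat \<Rightarrow> nat \<Rightarrow> (nat \<Rightarrow> complex) \<Rightarrow>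
     nat \<Rightarrow> nat \<Rightarrow> real" where
  "bs_Delta_m d ep em \<alpha> d' ep' em' \<alpha>' m l =
     (if real l \<le> d_eps d ep em then bs_Delta d ep em \<alpha> l
      else if real l < real m - d_eps d' ep' em' then 1
      else bs_Delta d' ep' em' \<alpha>' (m - l))"

definition bs_J ::
    "nat \<Rightarrow> nat \<Rightarrow> nat \<Rightarrow> (nat \<Rightarrow> complex) \<Rightarrow> nat \<Rightarrow> nat \<Rightarrow> nat \<Rightarrow> (nat \<Rightarrow> complex) \<Rightarrow>
     nat \<Rightarrow> real Matrix.mat" where
  "bs_J d ep em \<alpha> d' ep' em' \<alpha>' m =
     mat_diag (m + 1) (\<lambda>l. sqrt (bs_Delta_m d ep em \<alpha> d' ep' em' \<alpha>' m l)) *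
     bs_L d ep em \<alpha> d' ep' em' \<alpha>' m *
     mat_diag (m + 1) (\<lambda>l. 1 / sqrt (bs_Delta_m d ep em \<alpha> d' ep' em' \<alpha>' m l))"

end

(* Write z = e^{i xi} and q_l = c(xi) z^l + c(-xi) z^{-l}, a polynomial in 2 cos xi for every
   integer l.  On the circle q_l w is, up to xi -> -xi, z^l / (2 pi c(-xi)), and 1/c(-xi) is
   holomorphic in the closed unit disc, so q_l is orthogonal to the polynomials of degree < l.
   As soon as deg q_l <= l, that is l >= d_eps, this forces q_l = p_l / Delta_l, and Delta_l = 1
   for l > d_eps, where q_l is monic.  Hence the constant rows of L are instances of the
   recurrences of both families, and L is a Jacobi matrix of the first family glued to a reversed
   Jacobi matrix of the second.  Splitting the continuant at the seam gives
   q_n q~_{m+1-n} - q_{n-1} q~_{m-n}, in which the mixed terms cancel, leaving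
   c(xi) c~(xi) (1 - z^{-2}) z^{m+1} plus its image under xi -> -xi; this is Q.
   That sum vanishes when the quotient of its two terms is -1.  Since the Poisson kernel integrates
   to the argument of (1 + alpha e^{-i xi}) / (1 + alpha e^{i xi}), this is the exponential of the
   node equation, whose left-hand side increases strictly from 0 at xi = 0 to
   pi (2m + ep + em + ep' + em') at xi = pi.  So the m + 1 nodes give m + 1 distinct zeros. *)

theory Submission
  imports Defs
begin

section \<open>Real polynomials at complex arguments\<close>

text \<open>Everything is carried by real polynomials in 2 cos \<xi>. The poles of c sit at e^{i
  \<xi>} = 1 and -1, so identities are verified where sin \<xi> is nonzero and extended by
  continuity or by having infinitely many zeros. The delicate point is where to cut the matrix. At l
  = d_eps, if this is an integer, q_l is already a multiple of p_l, but \<Delta>_l need not be 1;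
  and b_l = 0 requires q_{l-1}, q_l and q_{l+1} to be such multiples at once. A cut before row n
  works if n - 1 \<ge> d_eps and m - n \<ge> d~_eps, and such an n exists exactly when m exceeds the
  sum of the two ceilings. As d_eps can be -1, a block may be empty; the vanishing of q_{-1} covers
  that case. The signs 1 - eps~ in Q supply the linear factors that complete the denominator of c~
  to 1 - z^{-2}. So c~ (1 - z^{-2}) is a polynomial in 1/z, and the modified e_k are its
  coefficients. For a node at 0 or pi the quotient argument breaks down, since z^2 = 1 there;
  instead each of the two terms vanishes on its own.\<close>

definition ceval :: "real poly \<Rightarrow> complex \<Rightarrow> complex" where
  "ceval p x = poly (map_poly of_real p) x"

lemma ceval_0 [simp]: "ceval 0 x = 0"
  by (simp add: ceval_def)

lemma ceval_pCons [simp]: "ceval (pCons a p) x = of_real a + x * ceval p x"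
  by (simp add: ceval_def map_poly_pCons)

lemma ceval_1 [simp]: "ceval 1 x = 1"
  by (simp add: one_pCons)

lemma ceval_add [simp]: "ceval (p + q) x = ceval p x + ceval q x"
proof -
  have "map_poly complex_of_real (p + q) = map_poly of_real p + map_poly of_real q"
    by (intro poly_eqI) (simp add: coeff_map_poly)
  then show ?thesis by (simp add: ceval_def)
qed

lemma ceval_smult [simp]: "ceval (Polynomial.smult a p) x = of_real a * ceval p x"
  by (induction p) (auto simp: algebra_simps)

lemma ceval_diff [simp]: "ceval (p - q) x = ceval p x - ceval q x"
  using ceval_add[of "p - q" q x] by simp

lemma ceval_mult [simp]: "ceval (p * q) x = ceval p x * ceval q x"
  by (induction p) (auto simp: algebra_simps)

lemma ceval_sum [simp]: "ceval (sum f A) x = (\<Sum>i\<in>A. ceval (f i) x)"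
  by (induction A rule: infinite_finite_induct) auto

lemma ceval_of_real: "ceval p (of_real x) = of_real (poly p x)"
  by (induction p) auto

lemma degree_complex_poly [simp]: "degree (map_poly complex_of_real p) = degree p"
  by (rule degree_map_poly) auto

lemma isCont_ceval [continuous_intros]:
  "isCont f x \<Longrightarrow> isCont (\<lambda>x. ceval p (f x)) x"
  unfolding ceval_def by (intro continuous_intros)

section \<open>Chebyshev polynomials of the four kinds\<close>

text \<open>The polynomials are taken in \<open>x = 2 cos \<xi>\<close>, so that they are monic (up to the constant \<open>2\<close> of the
  first kind); the signs \<open>(0,0)\<close>, \<open>(1,1)\<close>, \<open>(1,0)\<close>, \<open>(0,1)\<close> give the first, second, third
  and fourth kind.\<close>

fun hpoly :: "nat \<Rightarrow> nat \<Rightarrow> nat \<Rightarrow> real poly" where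
  "hpoly ep em 0 = (if ep = 0 \<and> em = 0 then [:2:] else [:1:])"
| "hpoly ep em (Suc 0) = [:real em - real ep, 1:]"
| "hpoly ep em (Suc (Suc n)) = [:0, 1:] * hpoly ep em (Suc n) - hpoly ep em n"

text \<open>Extension to negative indices by the reflection \<open>n \<mapsto> - n - ep - em\<close>; the remaining
  case is \<open>ep = em = 1\<close>, \<open>n = - 1\<close>.\<close>

definition hpolyZ :: "nat \<Rightarrow> nat \<Rightarrow> int \<Rightarrow> real poly" where
  "hpolyZ ep em n = (if n \<ge> 0 then hpoly ep em (nat n)
     else if n + int ep + int em > 0 then 0
     else Polynomial.smult ((-1) ^ em) (hpoly ep em (nat (- n - int ep - int em))))"

lemma coeff_hpoly_above: "i > n \<Longrightarrow> Polynomial.coeff (hpoly ep em n) i = 0"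
  by (induction ep em n arbitrary: i rule: hpoly.induct)
     (auto simp: coeff_pCons split: nat.splits)

lemma coeff_hpoly_top:
  "Polynomial.coeff (hpoly ep em n) n = (if n = 0 \<and> ep = 0 \<and> em = 0 then 2 else 1)"
  by (induction ep em n rule: hpoly.induct)
     (auto simp: coeff_pCons coeff_hpoly_above split: nat.splits)

lemma coeff_hpolyZ_above:
  assumes "int i > n" "int i > - n - int ep - int em"
  shows "Polynomial.coeff (hpolyZ ep em n) i = 0"
proof -
  have "n \<ge> 0 \<Longrightarrow> i > nat n"
    and "n + int ep + int em \<le> 0 \<Longrightarrow> i > nat (- n - int ep - int em)"
    using assms by linarith+
  then show ?thesis
    by (auto simp: hpolyZ_def coeff_hpoly_above)
qed

definition bs_den :: "nat \<Rightarrow> nat \<Rightarrow> complex \<Rightarrow> complex" where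
  "bs_den ep em z = (1 + of_nat ep * inverse z) * (1 - of_nat em * inverse z)"

text \<open>The function q_n of a family without parameters, in the variable z = e^{i \<xi>}.
  Expanding the product over the parameters in powers of 1/z writes q_l as a combination of these
  with indices l, l - 1, ..., l - d, some of which may be negative.\<close>

definition hker :: "nat \<Rightarrow> nat \<Rightarrow> int \<Rightarrow> complex \<Rightarrow> complex" where
  "hker ep em n z = z powi n / bs_den ep em z + z powi (- n) / bs_den ep em (inverse z)"

text \<open>From 1 + z = z (1 + 1/z) and 1 - z = - z (1 - 1/z). This produces both the reflection of
  negative indices and a sign that matters at the nodes.\<close>

lemma bs_den_inverse:
  assumes "ep \<in> {0, 1}" "em \<in> {0, 1}" "z \<noteq> 0"
  shows "bs_den ep em (inverse z) = (-1) ^ em * z powi (int ep + int em) * bs_den ep em z"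
proof -
  have 1: "1 + of_nat ep * z = z ^ ep * (1 + of_nat ep * inverse z)"
    using assms by (auto simp: field_simps)
  have 2: "1 - of_nat em * z = (- 1) ^ em * z ^ em * (1 - of_nat em * inverse z)"
    using assms by (auto simp: field_simps)
  have 3: "z powi (int ep + int em) = z ^ ep * z ^ em"
    using assms by (simp add: power_int_add)
  show ?thesis
    unfolding bs_den_def inverse_inverse_eq 1 2 3 by (simp add: mult_ac)
qed

lemma hker_rec:
  assumes "z \<noteq> 0"
  shows "hker ep em (n + 1) z = (z + inverse z) * hker ep em n z - hker ep em (n - 1) z"
proof -
  have *: "z powi (n + 1) = z * z powi n" "z powi (- (n + 1)) = inverse z * z powi (- n)"
    "z powi (n - 1) = inverse z * z powi n" "z powi (- (n - 1)) = z * z powi (- n)"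
    using assms by (auto simp: power_int_diff power_int_add field_simps power_int_minus)
  show ?thesis
    unfolding hker_def * by (simp add: algebra_simps add_divide_distrib)
qed

lemma hker_reflect:
  assumes "ep \<in> {0, 1}" "em \<in> {0, 1}" "z \<noteq> 0" "bs_den ep em z \<noteq> 0"
  shows "hker ep em (- n - int ep - int em) z = (-1) ^ em * hker ep em n z"
proof -
  have a: "z powi (- n - int ep - int em) = z powi (- n) / z powi (int ep + int em)"
    using assms by (simp add: power_int_diff power_int_add)
  have b: "z powi (- (- n - int ep - int em)) = z powi n * z powi (int ep + int em)"
    using assms by (simp flip: power_int_add) (simp add: algebra_simps)
  have c: "((-1) ^ em :: complex) * (-1) ^ em = 1"
    by (simp flip: power_mult_distrib)
  have d: "(1 :: complex) / (-1) ^ em = (-1) ^ em"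
    using c by (simp add: field_simps)
  have nz: "z powi (int ep + int em) \<noteq> 0"
    using assms by simp
  show ?thesis
    unfolding hker_def a b bs_den_inverse[OF assms(1-3)]
    using nz assms c by (simp add: field_simps)
qed

lemma hker_0_1:
  assumes "ep \<in> {0, 1}" "em \<in> {0, 1}" "z \<noteq> 0" "bs_den ep em z \<noteq> 0"
  shows "hker ep em 0 z = ceval (hpoly ep em 0) (z + inverse z)"
    "hker ep em 1 z = ceval (hpoly ep em 1) (z + inverse z)"
proof -
  have nz: "bs_den ep em (inverse z) \<noteq> 0"
    using assms by (simp add: bs_den_inverse)
  show "hker ep em 0 z = ceval (hpoly ep em 0) (z + inverse z)"
    using assms nz by (auto simp: hker_def bs_den_def divide_simps) (simp_all add: algebra_simps)
  show "hker ep em 1 z = ceval (hpoly ep em 1) (z + inverse z)"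
    using assms nz by (auto simp: hker_def bs_den_def divide_simps power_int_minus) (simp_all add: algebra_simps)
qed

lemma hker_nat_eq_hpoly:
  assumes "ep \<in> {0, 1}" "em \<in> {0, 1}" "z \<noteq> 0" "bs_den ep em z \<noteq> 0"
  shows "hker ep em (int n) z = ceval (hpoly ep em n) (z + inverse z)"
  using assms
proof (induction ep em n rule: hpoly.induct)
  case (3 ep em n)
  then show ?case
    using hker_rec[of z ep em "int (Suc n)"] by (simp add: algebra_simps)
qed (use hker_0_1 in auto)

lemma hker_eq_hpolyZ:
  assumes "ep \<in> {0, 1}" "em \<in> {0, 1}" "z \<noteq> 0" "bs_den ep em z \<noteq> 0"
  shows "hker ep em n z = ceval (hpolyZ ep em n) (z + inverse z)"
proof -
  consider "n \<ge> 0" | "n < 0" "n + int ep + int em > 0" | "n + int ep + int em \<le> 0" "n < 0"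
    by linarith
  then show ?thesis
  proof cases
    case 1
    then show ?thesis using hker_nat_eq_hpoly[OF assms, of "nat n"] by (simp add: hpolyZ_def)
  next
    case 2
    \<comment> \<open>The reflection fixes this index and carries the sign -1, so the value is its
      own negative.\<close>
    then have n: "ep = 1" "em = 1" "n = -1" using assms by auto
    then show ?thesis
      using hker_reflect[OF assms, of "-1"] by (auto simp: hpolyZ_def)
  next
    case 3
    have "hker ep em n z = (-1) ^ em * hker ep em (int (nat (- n - int ep - int em))) z"
      using hker_reflect[OF assms, of n] 3 by (simp add: power_mult_distrib[symmetric])
    then show ?thesis
      using 3 hker_nat_eq_hpoly[OF assms, of "nat (- n - int ep - int em)"]
      by (simp add: hpolyZ_def)
  qed
qed

lemma hpoly_cos: "poly (hpoly 0 0 n) (2 * cos \<xi>) = 2 * cos (real n * \<xi>)"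
proof (induction "0::nat" "0::nat" n rule: hpoly.induct)
  case (3 n)
  have "cos ((2 + real n) * \<xi>) + cos (real n * \<xi>) = 2 * cos \<xi> * cos ((1 + real n) * \<xi>)"
    using cos_plus_cos[of "(2 + real n) * \<xi>" "real n * \<xi>"] by (simp add: algebra_simps add_divide_distrib)
  then show ?case using 3 by (simp add: algebra_simps)
qed auto

definition cos_poly :: "nat \<Rightarrow> real poly" where
  "cos_poly n = (if n = 0 then 1 else hpoly 0 0 n)"

lemma cos_mono_poly: "cos_mono n \<xi> = poly (cos_poly n) (2 * cos \<xi>)"
  by (simp add: cos_mono_def cos_poly_def hpoly_cos)

lemma coeff_cos_poly_above: "i > n \<Longrightarrow> Polynomial.coeff (cos_poly n) i = 0"
  by (auto simp: cos_poly_def coeff_hpoly_above)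

lemma coeff_cos_poly_top: "Polynomial.coeff (cos_poly n) n = 1"
  by (auto simp: cos_poly_def coeff_hpoly_top)

section \<open>Orthogonal polynomials of a positive definite functional\<close>

text \<open>Gram-Schmidt and the three-term recurrence see the weight only through the integral of p
  against it, so they are developed for any positive definite functional. \<open>opoly\<close>
  repeats the recursion of \<open>gs_orth\<close> inside the polynomial ring, where degrees and
  leading coefficients are available.\<close>

locale pos_def_functional =
  fixes \<Lambda> :: "real poly \<Rightarrow> real"
  assumes Lam_add: "\<Lambda> (p + q) = \<Lambda> p + \<Lambda> q"
    and Lam_smult: "\<Lambda> (Polynomial.smult a p) = a * \<Lambda> p"
    and Lam_pos: "p \<noteq> 0 \<Longrightarrow> \<Lambda> (p * p) > 0"
begin

lemma Lam_0 [simp]: "\<Lambda> 0 = 0"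
  using Lam_smult[of 0 0] by simp

lemma Lam_diff: "\<Lambda> (p - q) = \<Lambda> p - \<Lambda> q"
  using Lam_add[of "p - q" q] by simp

lemma Lam_sum: "\<Lambda> (\<Sum>i\<in>A. f i) = (\<Sum>i\<in>A. \<Lambda> (f i))"
  by (induction A rule: infinite_finite_induct) (auto simp: Lam_add)

fun opoly :: "nat \<Rightarrow> real poly" where
  "opoly l = cos_poly l -
     (\<Sum>k<l. Polynomial.smult (\<Lambda> (cos_poly l * opoly k) / \<Lambda> (opoly k * opoly k)) (opoly k))"

declare opoly.simps [simp del]

definition \<delta> :: "nat \<Rightarrow> real" where
  "\<delta> l = \<Lambda> (opoly l * opoly l)"

lemma coeff_opoly_above: "i > l \<Longrightarrow> Polynomial.coeff (opoly l) i = 0"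
proof (induction l arbitrary: i rule: less_induct)
  case (less l)
  then show ?case
    by (subst opoly.simps) (auto simp: coeff_sum coeff_cos_poly_above intro!: sum.neutral)
qed

lemma coeff_opoly_top [simp]: "Polynomial.coeff (opoly l) l = 1"
  by (subst opoly.simps) (auto simp: coeff_sum coeff_cos_poly_top coeff_opoly_above intro!: sum.neutral)

lemma opoly_nonzero [simp]: "opoly l \<noteq> 0"
  using coeff_opoly_top[of l] by (metis coeff_0 zero_neq_one)

lemma degree_opoly [simp]: "degree (opoly l) = l"
  by (intro antisym degree_le le_degree) (auto simp: coeff_opoly_above)

lemma \<delta>_pos: "\<delta> l > 0"
  by (simp add: \<delta>_def Lam_pos)

lemma \<delta>_nonzero [simp]: "\<delta> l \<noteq> 0"
  using \<delta>_pos[of l] by simp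

text \<open>A monic triangular family spans the polynomials of degree < l: subtract the leading
  coefficient times \<open>B j\<close> and lower the degree bound. It serves both for the orthogonal
  family and for the cosine basis.\<close>

lemma orth_span:
  assumes "\<And>k i. i > k \<Longrightarrow> Polynomial.coeff (B k) i = 0" "\<And>k. Polynomial.coeff (B k) k = 1"
    and "\<And>k. k < l \<Longrightarrow> \<Lambda> (r * B k) = 0"
    and "\<And>i. i \<ge> l \<Longrightarrow> Polynomial.coeff g i = 0"
  shows "\<Lambda> (r * g) = 0"
proof -
  have "j \<le> l \<Longrightarrow> (\<And>i. i \<ge> j \<Longrightarrow> Polynomial.coeff g i = 0) \<Longrightarrow> \<Lambda> (r * g) = 0" for j
  proof (induction j arbitrary: g)
    case 0
    then have "g = 0" by (intro poly_eqI) auto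
    then show ?case by simp
  next
    case (Suc j)
    define c where "c = Polynomial.coeff g j"
    have "\<Lambda> (r * (g - Polynomial.smult c (B j))) = 0"
    proof (rule Suc.IH)
      fix i assume "i \<ge> j"
      then show "Polynomial.coeff (g - Polynomial.smult c (B j)) i = 0"
        using Suc.prems assms(1,2) by (cases "i = j") (auto simp: c_def)
    qed (use Suc.prems in auto)
    moreover have "\<Lambda> (r * B j) = 0"
      using Suc.prems assms(3) by simp
    ultimately show ?case
      by (simp add: right_diff_distrib Lam_diff Lam_smult)
  qed
  then show ?thesis using assms(4) by blast
qed

lemma opoly_orth_less: "k < l \<Longrightarrow> \<Lambda> (opoly l * opoly k) = 0"
proof (induction l arbitrary: k rule: less_induct)
  case (less l)
  have *: "\<Lambda> (opoly j * opoly k) = (if j = k then \<delta> k else 0)" if "j < l" for j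
    using less.IH[of j k] less.IH[of k j] less.prems that
    by (cases j k rule: linorder_cases) (auto simp: \<delta>_def mult.commute)
  have "\<Lambda> (opoly l * opoly k) = \<Lambda> (cos_poly l * opoly k) -
      (\<Sum>j<l. \<Lambda> (cos_poly l * opoly j) / \<delta> j * \<Lambda> (opoly j * opoly k))"
    by (subst opoly.simps) (simp add: left_diff_distrib Lam_diff sum_distrib_right Lam_sum Lam_smult \<delta>_def)
  also have "(\<Sum>j<l. \<Lambda> (cos_poly l * opoly j) / \<delta> j * \<Lambda> (opoly j * opoly k)) =
      (\<Sum>j<l. if j = k then \<Lambda> (cos_poly l * opoly k) else 0)"
    by (intro sum.cong) (auto simp: *)
  finally show ?case using less.prems by simp
qed

lemma opoly_orth: "k \<noteq> l \<Longrightarrow> \<Lambda> (opoly l * opoly k) = 0"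
  using opoly_orth_less[of k l] opoly_orth_less[of l k]
  by (cases k l rule: linorder_cases) (auto simp: mult.commute)

lemma opoly_orth_lower:
  assumes "\<And>i. i \<ge> l \<Longrightarrow> Polynomial.coeff g i = 0"
  shows "\<Lambda> (opoly l * g) = 0"
  by (rule orth_span[where B = opoly and l = l]) (auto simp: assms coeff_opoly_above opoly_orth)

text \<open>Such a \<open>g\<close> lies in the span of the polynomials to which it is orthogonal,
  so it is orthogonal to itself.\<close>

lemma eq_0_if_orth:
  assumes "\<And>i. i \<ge> l \<Longrightarrow> Polynomial.coeff g i = 0" "\<And>k. k < l \<Longrightarrow> \<Lambda> (g * opoly k) = 0"
  shows "g = 0"
proof -
  have "\<Lambda> (g * g) = 0"
    by (rule orth_span[where B = opoly and l = l]) (auto simp: assms coeff_opoly_above)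
  then show ?thesis using Lam_pos[of g] by auto
qed

definition \<beta> :: "nat \<Rightarrow> real" where
  "\<beta> l = \<Lambda> ([:0, 1:] * opoly l * opoly l) / \<delta> l"

lemma opoly_rec:
  "[:0, 1:] * opoly l = opoly (Suc l) + Polynomial.smult (\<beta> l) (opoly l) +
     (if l = 0 then 0 else Polynomial.smult (\<delta> l / \<delta> (l - 1)) (opoly (l - 1)))"
proof -
  define x where "x = [:0, 1 :: real:]"
  define lo where "lo = (if l = 0 then 0 else Polynomial.smult (\<delta> l / \<delta> (l - 1)) (opoly (l - 1)))"
  define g where "g = x * opoly l - (opoly (Suc l) + Polynomial.smult (\<beta> l) (opoly l) + lo)"
  have xc: "Polynomial.coeff (x * p) i = (if i = 0 then 0 else Polynomial.coeff p (i - 1))" for p i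
    by (cases i) (auto simp: x_def)
  have "g = 0"
  proof (rule eq_0_if_orth[of "Suc l"])
    fix i assume i: "i \<ge> Suc l"
    have "Polynomial.coeff lo i = 0" "Polynomial.coeff (opoly l) i = 0"
      using i by (auto simp: lo_def coeff_opoly_above)
    moreover have "Polynomial.coeff (x * opoly l) i = Polynomial.coeff (opoly (Suc l)) i"
      using i by (cases "i = Suc l") (auto simp: xc coeff_opoly_above)
    ultimately show "Polynomial.coeff g i = 0"
      by (simp add: g_def)
  next
    fix k assume k: "k < Suc l"
    have *: "\<Lambda> (g * opoly k) = \<Lambda> (opoly l * (x * opoly k)) - \<beta> l * \<Lambda> (opoly l * opoly k) - \<Lambda> (lo * opoly k)"
    proof -
      have "g * opoly k = opoly l * (x * opoly k) - Polynomial.smult (\<beta> l) (opoly l * opoly k)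
          - lo * opoly k - opoly (Suc l) * opoly k"
        by (simp add: g_def algebra_simps)
      then show ?thesis
        using k by (simp add: Lam_diff Lam_smult opoly_orth)
    qed
    consider "k = l" | "l = Suc k" | "Suc k < l"
      using k by linarith
    then show "\<Lambda> (g * opoly k) = 0"
    proof cases
      case 1
      have "\<Lambda> (lo * opoly k) = 0"
        using 1 by (auto simp: lo_def Lam_smult opoly_orth)
      then show ?thesis
        using 1 unfolding * \<beta>_def x_def[symmetric] by (simp add: \<delta>_def[symmetric] mult_ac)
    next
      case 2
      \<comment> \<open>\<open>x * opoly k\<close> is monic of degree \<open>l\<close>, so it
        differs from \<open>opoly l\<close> by lower terms and pairs with it to
        \<open>\<delta> l\<close>; this is the origin of the quotient of norms.\<close>
      have "\<Lambda> (opoly l * (x * opoly k - opoly l)) = 0"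
        by (rule opoly_orth_lower) (use 2 in \<open>auto simp: xc coeff_opoly_above Suc_le_eq le_less\<close>)
      moreover have "\<Lambda> (lo * opoly k) = \<delta> l"
        using 2 by (simp add: lo_def Lam_smult \<delta>_def[symmetric])
      ultimately show ?thesis
        unfolding * using 2 by (simp add: opoly_orth right_diff_distrib Lam_diff \<delta>_def)
    next
      case 3
      have "\<Lambda> (opoly l * (x * opoly k)) = 0"
        by (rule opoly_orth_lower) (use 3 in \<open>auto simp: xc coeff_opoly_above\<close>)
      moreover have "\<Lambda> (lo * opoly k) = 0"
        using 3 by (auto simp: lo_def Lam_smult opoly_orth)
      ultimately show ?thesis
        unfolding * using 3 by (simp add: opoly_orth)
    qed
  qed
  then show ?thesis
    by (simp add: g_def x_def lo_def)
qed

text \<open>The scalar is fixed by one pairing instead of the leading coefficient of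
  \<open>r\<close>: at l = d_eps the degree of q_l is controlled, but its leading coefficient need
  not be 1.\<close>

lemma opoly_unique:
  assumes "\<And>i. i > l \<Longrightarrow> Polynomial.coeff r i = 0"
    and "\<And>k. k < l \<Longrightarrow> \<Lambda> (r * cos_poly k) = 0" "\<Lambda> (r * cos_poly l) = 1"
  shows "r = Polynomial.smult (1 / \<delta> l) (opoly l)"
proof -
  define c where "c = Polynomial.coeff r l"
  have lower: "\<Lambda> (r * g) = 0" if "\<And>i. i \<ge> l \<Longrightarrow> Polynomial.coeff g i = 0" for g
    by (rule orth_span[where B = cos_poly and l = l])
       (auto simp: assms that coeff_cos_poly_above coeff_cos_poly_top)
  have "r - Polynomial.smult c (opoly l) = 0"
  proof (rule eq_0_if_orth[of l])
    fix i assume "i \<ge> l"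
    then show "Polynomial.coeff (r - Polynomial.smult c (opoly l)) i = 0"
      using assms(1) by (cases "i = l") (auto simp: c_def coeff_opoly_above)
  next
    fix k assume "k < l"
    then show "\<Lambda> ((r - Polynomial.smult c (opoly l)) * opoly k) = 0"
      using lower[of "opoly k"]
      by (simp add: left_diff_distrib Lam_diff Lam_smult opoly_orth coeff_opoly_above)
  qed
  then have r: "r = Polynomial.smult c (opoly l)" by simp
  have "Polynomial.coeff (opoly l - cos_poly l) i = 0" if "i \<ge> l" for i
    using that by (cases "i = l") (auto simp: coeff_opoly_above coeff_cos_poly_above coeff_cos_poly_top)
  then have "\<Lambda> (r * (opoly l - cos_poly l)) = 0"
    by (rule lower)
  then have "\<Lambda> (r * opoly l) = 1"
    using assms(3) by (simp add: right_diff_distrib Lam_diff)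
  then have "c * \<delta> l = 1"
    using r by (simp add: Lam_smult \<delta>_def)
  then have "c = 1 / \<delta> l"
    by (simp add: field_simps)
  then show ?thesis using r by simp
qed

end

section \<open>Elementary symmetric polynomials and conjugate pairs\<close>

lemma prod_linear_eq_elem_sym:
  "(\<Prod>r = 1..d. 1 + \<alpha> r * x) = (\<Sum>k\<le>d. elem_sym d \<alpha> (int k) * x ^ k)"
proof -
  have "(\<Prod>r = 1..d. 1 + \<alpha> r * x) = (\<Prod>r = 1..d. \<alpha> r * x + 1)"
    by (simp add: add.commute)
  also have "\<dots> = (\<Sum>S\<in>Pow {1..d}. (\<Prod>r\<in>S. \<alpha> r) * x ^ card S)"
    by (subst prod_add) (auto simp: prod.distrib)
  also have "\<dots> = (\<Sum>k\<le>d. \<Sum>S\<in>{S \<in> Pow {1..d}. card S = k}. (\<Prod>r\<in>S. \<alpha> r) * x ^ card S)"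
  proof (rule sum.group[symmetric])
    show "card ` Pow {1..d} \<subseteq> {..d}"
    proof safe
      fix S assume "S \<subseteq> {1..d}"
      then show "card S \<le> d" using card_mono[of "{1..d}" S] by simp
    qed
  qed simp_all
  also have "\<dots> = (\<Sum>k\<le>d. elem_sym d \<alpha> (int k) * x ^ k)"
    by (intro sum.cong) (auto simp: elem_sym_def sum_distrib_right intro!: sum.cong)
  finally show ?thesis .
qed

lemma elem_sym_above: "k > int d \<Longrightarrow> elem_sym d \<alpha> k = 0"
proof -
  assume "k > int d"
  then have "{S. S \<subseteq> {1..d} \<and> card S = nat k} = {}"
  proof safe
    fix S assume "S \<subseteq> {1..d}" "card S = nat k"
    then show "S \<in> {}" using card_mono[of "{1..d}" S] \<open>k > int d\<close> by simp
  qed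
  then show ?thesis by (simp only: elem_sym_def) simp
qed

lemma elem_sym_neg: "k < 0 \<Longrightarrow> elem_sym d \<alpha> k = 0"
  by (simp add: elem_sym_def)

lemma elem_sym_0 [simp]: "elem_sym d \<alpha> 0 = 1"
proof -
  have "{S. S \<subseteq> {1..d} \<and> card S = 0} = {{}}"
  proof safe
    fix S x assume "S \<subseteq> {1..d}" "card S = 0" "x \<in> S"
    then show "x \<in> {}" using finite_subset[of S "{1..d}"] by simp
  qed auto
  then show ?thesis by (simp add: elem_sym_def)
qed

lemma count_image_mset_set:
  "finite A \<Longrightarrow> count (image_mset g (mset_set A)) z = card {r \<in> A. g r = z}"
proof (induction rule: finite_induct)
  case (insert x F)
  have "{r \<in> insert x F. g r = z} = (if g x = z then insert x {r \<in> F. g r = z} else {r \<in> F. g r = z})"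
    by auto
  then show ?case using insert by simp
qed simp

text \<open>Pairing is given by multiplicities. As a multiset identity it makes symmetric
  expressions in the parameters invariant under conjugation, without choosing a permutation of the
  indices.\<close>

lemma conj_paired_mset:
  assumes "conj_paired d \<alpha>"
  shows "image_mset (\<lambda>r. cnj (\<alpha> r)) (mset_set {1..d}) = image_mset \<alpha> (mset_set {1..d})"
proof (rule multiset_eqI)
  fix z
  have count: "count (image_mset g (mset_set {1..d})) z = card {r \<in> {1..d}. g r = z}" for g :: "nat \<Rightarrow> complex"
    by (rule count_image_mset_set) simp
  have "{r \<in> {1..d}. cnj (\<alpha> r) = z} = {r \<in> {1..d}. \<alpha> r = cnj z}"
    by auto
  moreover have "card {r \<in> {1..d}. \<alpha> r = cnj z} = card {r \<in> {1..d}. \<alpha> r = z}"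
  proof (cases "z \<in> \<real>")
    case False
    then have "card {r \<in> {1..d}. \<alpha> r = z} = card {r \<in> {1..d}. \<alpha> r = cnj z}"
      using assms unfolding conj_paired_def by blast
    then show ?thesis by (rule sym)
  qed (simp add: Reals_cnj_iff)
  ultimately show "count (image_mset (\<lambda>r. cnj (\<alpha> r)) (mset_set {1..d})) z = count (image_mset \<alpha> (mset_set {1..d})) z"
    by (simp only: count)
qed

lemma conj_paired_prod:
  assumes "conj_paired d \<alpha>"
  shows "(\<Prod>r = 1..d. f (cnj (\<alpha> r))) = (\<Prod>r = 1..d. f (\<alpha> r))"
proof -
  have "prod_mset (image_mset f (image_mset (\<lambda>r. cnj (\<alpha> r)) (mset_set {1..d}))) =
      prod_mset (image_mset f (image_mset \<alpha> (mset_set {1..d})))"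
    by (simp only: conj_paired_mset[OF assms])
  then show ?thesis
    by (simp only: image_mset.compositionality comp_def prod_unfold_prod_mset)
qed

lemma conj_paired_sum:
  assumes "conj_paired d \<alpha>"
  shows "(\<Sum>r = 1..d. f (cnj (\<alpha> r))) = (\<Sum>r = 1..d. f (\<alpha> r))"
proof -
  have "sum_mset (image_mset f (image_mset (\<lambda>r. cnj (\<alpha> r)) (mset_set {1..d}))) =
      sum_mset (image_mset f (image_mset \<alpha> (mset_set {1..d})))"
    by (simp only: conj_paired_mset[OF assms])
  then show ?thesis
    by (simp only: image_mset.compositionality comp_def sum_unfold_sum_mset)
qed

text \<open>The polynomial with linear factors 1 + \<alpha>_r x is unchanged when its coefficients
  are conjugated. This is what makes q_l a real polynomial in 2 cos \<xi>.\<close>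

lemma elem_sym_real:
  assumes "conj_paired d \<alpha>"
  shows "elem_sym d \<alpha> k \<in> \<real>"
proof -
  have "cnj (elem_sym d \<alpha> (int k)) = elem_sym d \<alpha> (int k)" if "k \<le> d" for k
  proof -
    have "(\<Sum>k\<le>d. cnj (elem_sym d \<alpha> (int k)) * x ^ k) = (\<Sum>k\<le>d. elem_sym d \<alpha> (int k) * x ^ k)" for x
    proof -
      have "(\<Sum>k\<le>d. cnj (elem_sym d \<alpha> (int k)) * x ^ k) = cnj (\<Prod>r = 1..d. 1 + \<alpha> r * cnj x)"
        by (simp only: prod_linear_eq_elem_sym) simp
      also have "\<dots> = (\<Prod>r = 1..d. 1 + cnj (\<alpha> r) * x)"
        by simp
      also have "\<dots> = (\<Prod>r = 1..d. 1 + \<alpha> r * x)"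
        by (rule conj_paired_prod[OF assms, of "\<lambda>a. 1 + a * x"])
      finally show ?thesis by (simp only: prod_linear_eq_elem_sym)
    qed
    then show ?thesis
      using that polyfun_eq_coeffs[of "\<lambda>k. cnj (elem_sym d \<alpha> (int k))" d "\<lambda>k. elem_sym d \<alpha> (int k)"] by simp
  qed
  from this[of "nat k"] show ?thesis
    by (cases "k < 0"; cases "k > int d") (simp_all add: elem_sym_above elem_sym_neg Reals_cnj_iff)
qed

section \<open>The Bernstein-Szegoe family\<close>

lemma eventually_sin_nonzero: "eventually (\<lambda>w. sin w \<noteq> 0) (at (\<xi> :: complex))"
proof (cases "sin \<xi> = 0")
  case False
  have "sin \<midarrow>\<xi>\<rightarrow> sin \<xi>"
    by (intro tendsto_intros)
  then show ?thesis using False by (rule tendsto_imp_eventually_ne)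
next
  case True
  then obtain n :: int where n: "\<xi> = of_real (n * pi)"
    by (auto simp: Complex_Transcendental.sin_eq_0)
  have "eventually (\<lambda>w. w \<in> ball \<xi> pi - {\<xi>}) (at \<xi>)"
    by (rule eventually_at_in_open) auto
  then show ?thesis
  proof eventually_elim
    case (elim w)
    show "sin w \<noteq> 0"
    proof
      assume "sin w = 0"
      then obtain n' :: int where n': "w = of_real (n' * pi)"
        by (auto simp: Complex_Transcendental.sin_eq_0)
      have "dist \<xi> w = \<bar>real_of_int (n - n')\<bar> * pi"
        unfolding n n' dist_of_real by (simp add: dist_real_def abs_mult flip: left_diff_distrib)
      then have "\<bar>real_of_int (n - n')\<bar> < 1"
        using elim by simp
      then have "n = n'" by linarith
      then show False using elim n n' by simp
    qed
  qed
qed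

text \<open>The poles of c(\<xi>) and c(-\<xi>) all have e^{i \<xi>} = 1 or -1, so a nonzero sine
  excludes them for every choice of signs.\<close>

lemma sin_nonzero_imp_exp_ne: "sin \<xi> \<noteq> 0 \<Longrightarrow> exp (\<i> * \<xi>) \<noteq> 1 \<and> exp (\<i> * \<xi>) \<noteq> - 1" for \<xi> :: complex
proof (rule ccontr)
  assume "sin \<xi> \<noteq> 0" "\<not> (exp (\<i> * \<xi>) \<noteq> 1 \<and> exp (\<i> * \<xi>) \<noteq> - 1)"
  moreover have "exp (- (\<i> * \<xi>)) = inverse (exp (\<i> * \<xi>))"
    by (rule exp_minus)
  ultimately show False
    by (auto simp: sin_exp_eq)
qed

lemma cos_exp_inverse: "2 * cos \<xi> = exp (\<i> * \<xi>) + inverse (exp (\<i> * \<xi>))" for \<xi> :: complex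
  by (simp add: cos_exp_eq exp_minus)

lemma exp_int_mult: "exp (\<i> * of_int l * \<xi>) = exp (\<i> * \<xi>) powi l"
proof -
  have "exp (\<i> * of_int l * \<xi>) = exp (of_int l * (\<i> * \<xi>))"
    by (simp add: mult_ac)
  then show ?thesis by (simp only: exp_power_int)
qed

text \<open>Cauchy's formula at the centre of the disc.\<close>

lemma mean_value_circle:
  assumes "continuous_on (cball 0 1) \<Phi>" "\<Phi> holomorphic_on ball 0 1"
  shows "((\<lambda>t. \<Phi> (cis t)) has_integral (2 * of_real pi * \<Phi> 0)) {0..2 * pi}"
proof -
  have "((\<lambda>u. \<Phi> u / (u - 0)) has_contour_integral (2 * of_real pi * \<i> * \<Phi> 0)) (circlepath 0 1)"
    by (rule Cauchy_integral_circlepath) (use assms in auto)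
  then have "((\<lambda>t. \<Phi> (0 + 1 * cis t) / (0 + 1 * cis t - 0) * 1 * \<i> * cis t) has_integral (2 * of_real pi * \<i> * \<Phi> 0)) {0..2 * pi}"
    unfolding circlepath_def by (subst (asm) has_contour_integral_part_circlepath_iff) auto
  then have "((\<lambda>t. \<i> * \<Phi> (cis t)) has_integral (\<i> * (2 * of_real pi * \<Phi> 0))) {0..2 * pi}"
    by (simp add: mult_ac)
  then have "((\<lambda>t. - \<i> * (\<i> * \<Phi> (cis t))) has_integral (- \<i> * (\<i> * (2 * of_real pi * \<Phi> 0)))) {0..2 * pi}"
    by (rule has_integral_mult_right)
  then show ?thesis by (simp flip: mult.assoc)
qed

text \<open>Pairings are integrals over (0, pi) of a function plus its image under \<xi> \<mapsto>
  -\<xi>; folding identifies them with integrals over the whole circle.\<close>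

lemma integral_0_2pi_fold:
  fixes f :: "real \<Rightarrow> complex"
  assumes "(f has_integral I) {0..2 * pi}"
  shows "((\<lambda>t. f t + f (2 * pi - t)) has_integral I) {0..pi}"
proof -
  have i: "f integrable_on {0..2 * pi}" using assms by auto
  have 1: "f integrable_on {0..pi}" "f integrable_on {pi..2 * pi}"
    using integrable_subinterval_real[OF i] by auto
  have "(f has_integral (integral {pi..2 * pi} f)) (cbox pi (2 * pi))"
    using 1 by (simp add: integrable_integral)
  from has_integral_affinity[OF this, of "- 1" "2 * pi"]
  have "((\<lambda>t. f (2 * pi - t)) has_integral (integral {pi..2 * pi} f)) ((\<lambda>x. 2 * pi - x) ` {pi..2 * pi})"
    by (simp add: algebra_simps)
  moreover have "(\<lambda>x. 2 * pi - x) ` {pi..2 * pi} = {0..pi}"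
    by (simp add: image_diff_atLeastAtMost)
  ultimately have "((\<lambda>t. f t + f (2 * pi - t)) has_integral (integral {0..pi} f + integral {pi..2 * pi} f)) {0..pi}"
    using 1 by (intro has_integral_add) (auto intro: integrable_integral)
  moreover have "integral {0..pi} f + integral {pi..2 * pi} f = I"
    using Henstock_Kurzweil_Integration.integral_combine[OF _ _ i, of pi] assms by (simp add: integral_unique)
  ultimately show ?thesis by simp
qed

locale bs_family =
  fixes d ep em :: nat and \<alpha> :: "nat \<Rightarrow> complex"
  assumes admissible: "admissible d ep em \<alpha>"
begin

lemma ep_em: "ep \<in> {0, 1}" "em \<in> {0, 1}" and paired: "conj_paired d \<alpha>"
  and \<alpha>_less_1: "r \<in> {1..d} \<Longrightarrow> cmod (\<alpha> r) < 1"
  using admissible by (auto simp: admissible_def)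

definition num :: "complex \<Rightarrow> complex" where
  "num z = (\<Prod>r = 1..d. 1 + \<alpha> r * z)"

abbreviation "den \<equiv> bs_den ep em"

text \<open>The zeros -1/\<alpha>_r lie outside the closed disc; this makes 1/c(-\<xi>) holomorphic
  inside.\<close>

lemma num_nonzero: "cmod z \<le> 1 \<Longrightarrow> num z \<noteq> 0"
proof -
  assume z: "cmod z \<le> 1"
  have "1 + \<alpha> r * z \<noteq> 0" if "r \<in> {1..d}" for r
  proof
    assume "1 + \<alpha> r * z = 0"
    then have "cmod (\<alpha> r) * cmod z = 1"
      by (metis add_eq_0_iff norm_minus_cancel norm_mult norm_one)
    then show False
      using \<alpha>_less_1[OF that] z mult_le_one[of "cmod z" "cmod (\<alpha> r)"] mult_left_le[of "cmod z" "cmod (\<alpha> r)"] by simp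
  qed
  then show ?thesis by (simp add: num_def)
qed

lemma num_cnj: "num (cnj z) = cnj (num z)"
proof -
  have "cnj (num z) = (\<Prod>r = 1..d. 1 + cnj (\<alpha> r) * cnj z)"
    by (simp add: num_def)
  also have "\<dots> = num (cnj z)"
    unfolding num_def by (rule conj_paired_prod[OF paired, of "\<lambda>a. 1 + a * cnj z"])
  finally show ?thesis by simp
qed

lemma den_cnj: "den (cnj z) = cnj (den z)"
  by (simp add: bs_den_def)

lemma den_nonzero: "z \<noteq> 1 \<Longrightarrow> z \<noteq> - 1 \<Longrightarrow> z \<noteq> 0 \<Longrightarrow> den z \<noteq> 0"
proof -
  assume z: "z \<noteq> 1" "z \<noteq> - 1" "z \<noteq> 0"
  show "den z \<noteq> 0"
  proof
    assume "den z = 0"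
    moreover have "z ^ 2 * den z = (z + of_nat ep) * (z - of_nat em)"
      using z by (simp add: bs_den_def field_simps power2_eq_square)
    ultimately have "(z + of_nat ep) * (z - of_nat em) = 0"
      by simp
    moreover have "z + 1 \<noteq> 0"
      using z by (metis eq_neg_iff_add_eq_0)
    ultimately show False
      using z ep_em by auto
  qed
qed

lemma bs_c_eq: "bs_c d ep em \<alpha> \<xi> = num (inverse (exp (\<i> * \<xi>))) / den (exp (\<i> * \<xi>))"
  by (simp add: bs_c_def num_def bs_den_def exp_minus divide_inverse)

text \<open>The polynomial of q_l in 2 cos \<xi>: the product over the parameters is expanded in
  powers of 1/z, and each power is combined with its mirror image through \<open>hpolyZ\<close>.
  Taking \<open>Re\<close> loses nothing, as conjugate pairing makes the coefficients real.\<close>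

definition rpoly :: "int \<Rightarrow> real poly" where
  "rpoly l = (\<Sum>k\<le>d. Polynomial.smult (Re (elem_sym d \<alpha> (int k))) (hpolyZ ep em (l - int k)))"

text \<open>The lowest index l - d reflects to d - l - ep - em, which is at most l exactly when l
  \<ge> d_eps. If the inequality is strict, only the index l itself reaches degree l, so q_l is
  monic.\<close>

lemma coeff_rpoly_above:
  assumes "real l \<ge> d_eps d ep em" "i > l"
  shows "Polynomial.coeff (rpoly (int l)) i = 0"
proof -
  have "Polynomial.coeff (hpolyZ ep em (int l - int k)) i = 0" if "k \<le> d" for k
    by (rule coeff_hpolyZ_above) (use that assms in \<open>auto simp: d_eps_def\<close>)
  then show ?thesis by (auto simp: rpoly_def coeff_sum intro!: sum.neutral)
qed

lemma coeff_rpoly_top: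
  assumes "real l > d_eps d ep em"
  shows "Polynomial.coeff (rpoly (int l)) l = 1"
proof -
  have "Polynomial.coeff (hpolyZ ep em (int l - int k)) l = (if k = 0 then 1 else 0)" if "k \<le> d" for k
  proof (cases "k = 0")
    case True
    have "\<not> (l = 0 \<and> ep = 0 \<and> em = 0)"
      using assms by (auto simp: d_eps_def)
    then show ?thesis using True by (simp add: hpolyZ_def coeff_hpoly_top)
  next
    case False
    then show ?thesis
      using that assms by (auto simp: d_eps_def intro!: coeff_hpolyZ_above)
  qed
  then have "Polynomial.coeff (rpoly (int l)) l = (\<Sum>k\<le>d. if k = 0 then 1 else 0)"
    unfolding rpoly_def coeff_sum by (intro sum.cong) auto
  then show ?thesis by simp
qed

lemma num_expand:
  assumes "z \<noteq> 0"
  shows "num (inverse z) * z powi l = (\<Sum>k\<le>d. of_real (Re (elem_sym d \<alpha> (int k))) * z powi (l - int k))"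
proof -
  have "num (inverse z) * z powi l = (\<Sum>k\<le>d. elem_sym d \<alpha> (int k) * inverse z ^ k * z powi l)"
    unfolding num_def prod_linear_eq_elem_sym by (simp add: sum_distrib_right)
  also have "\<dots> = (\<Sum>k\<le>d. of_real (Re (elem_sym d \<alpha> (int k))) * z powi (l - int k))"
    using assms elem_sym_real[OF paired]
    by (intro sum.cong) (auto simp: power_int_diff divide_inverse power_inverse mult_ac)
  finally show ?thesis .
qed

lemma rpoly_kernel:
  assumes "z \<noteq> 0" "den z \<noteq> 0"
  shows "num (inverse z) / den z * z powi l + num z / den (inverse z) * z powi (- l) =
    ceval (rpoly l) (z + inverse z)"
proof -
  have "num (inverse z) / den z * z powi l + num (inverse (inverse z)) / den (inverse z) * (inverse z) powi l =
    (\<Sum>k\<le>d. of_real (Re (elem_sym d \<alpha> (int k))) * z powi (l - int k)) / den z +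
    (\<Sum>k\<le>d. of_real (Re (elem_sym d \<alpha> (int k))) * (inverse z) powi (l - int k)) / den (inverse z)"
    using assms num_expand[of z l] num_expand[of "inverse z" l] by (simp add: times_divide_eq_left[symmetric] del: inverse_inverse_eq)
  also have "\<dots> = (\<Sum>k\<le>d. of_real (Re (elem_sym d \<alpha> (int k))) * hker ep em (l - int k) z)"
  proof -
    have "inverse z powi j = z powi (- j)" for j
      by (simp add: power_int_inverse power_int_minus)
    then show ?thesis
      by (simp only: hker_def sum_divide_distrib sum.distrib distrib_left times_divide_eq_right)
  qed
  also have "\<dots> = ceval (rpoly l) (z + inverse z)"
    using assms by (simp add: rpoly_def hker_eq_hpolyZ[OF ep_em])
  finally show ?thesis
    by (simp add: power_int_inverse power_int_minus)
qed

text \<open>Off the zeros of sin the two sides agree by direct computation. The right side is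
  continuous, hence it is the limit that \<open>remove_sings\<close> takes as value.\<close>

lemma bs_q_eq: "bs_q d ep em \<alpha> l \<xi> = ceval (rpoly l) (2 * cos \<xi>)"
proof -
  let ?f = "\<lambda>\<xi>. bs_c d ep em \<alpha> \<xi> * exp (\<i> * of_int l * \<xi>) + bs_c d ep em \<alpha> (- \<xi>) * exp (- \<i> * of_int l * \<xi>)"
  have "?f w = ceval (rpoly l) (2 * cos w)" if "sin w \<noteq> 0" for w
  proof -
    define z where "z = exp (\<i> * w)"
    have z: "z \<noteq> 0" "den z \<noteq> 0"
      using sin_nonzero_imp_exp_ne[OF that] den_nonzero by (auto simp: z_def)
    have m: "exp (\<i> * - w) = inverse z"
      by (simp add: z_def exp_minus)
    have e: "exp (- \<i> * of_int l * w) = z powi (- l)"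
      using exp_int_mult[of "- l" w] by (simp add: z_def)
    show ?thesis
      using rpoly_kernel[OF z, of l] unfolding cos_exp_inverse bs_c_eq m e exp_int_mult z_def[symmetric] by simp
  qed
  then have "eventually (\<lambda>w. ?f w = ceval (rpoly l) (2 * cos w)) (at \<xi>)"
    using eventually_sin_nonzero[of \<xi>] by (auto elim: eventually_mono)
  moreover have "(\<lambda>w. ceval (rpoly l) (2 * cos w)) \<midarrow>\<xi>\<rightarrow> ceval (rpoly l) (2 * cos \<xi>)"
    by (intro isContD continuous_intros)
  ultimately have "?f \<midarrow>\<xi>\<rightarrow> ceval (rpoly l) (2 * cos \<xi>)"
    by (simp cong: tendsto_cong add: filterlim_cong)
  then show ?thesis unfolding bs_q_def by (rule remove_sings_eqI)
qed

section \<open>The weight and its moment functional\<close>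

definition weight :: "real \<Rightarrow> real" where
  "weight \<xi> = (cmod (den (cis \<xi>)))\<^sup>2 / (2 * pi * (cmod (num (cis (- \<xi>))))\<^sup>2)"

text \<open>Valid at every real \<xi>: at a pole of c the convention \<open>inverse 0 = 0\<close>
  makes \<open>bs_c\<close> and hence \<open>bs_w\<close> vanish, which is also the continuous
  value.\<close>

lemma bs_w_eq: "bs_w d ep em \<alpha> \<xi> = weight \<xi>"
  by (simp add: bs_w_def weight_def bs_c_eq norm_divide power_divide flip: cis_conv_exp)

lemma continuous_weight [continuous_intros]: "continuous_on A weight"
proof -
  have "num (cis \<xi>) \<noteq> 0" for \<xi> by (rule num_nonzero) simp
  moreover have "continuous_on A (\<lambda>x. num (cis (- x)))" "continuous_on A (\<lambda>x. den (cis x))"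
    unfolding num_def bs_den_def by (intro continuous_intros; simp)+
  ultimately show ?thesis
    unfolding weight_def by (intro continuous_intros) auto
qed

lemma weight_nonneg: "weight \<xi> \<ge> 0"
  by (simp add: weight_def)

lemma cis_generic:
  assumes "\<xi> \<in> {0<..<pi}"
  shows "den (cis \<xi>) \<noteq> 0"
proof -
  have "sin \<xi> > 0" using assms by (auto intro: sin_gt_zero)
  then have "cis \<xi> \<noteq> 1" "cis \<xi> \<noteq> - 1" by (auto simp: complex_eq_iff)
  then show ?thesis by (intro den_nonzero) auto
qed

lemma weight_pos: "\<xi> \<in> {0<..<pi} \<Longrightarrow> weight \<xi> > 0"
  using cis_generic[of \<xi>] num_nonzero[of "cis (- \<xi>)"] by (simp add: weight_def)

definition Lam :: "real poly \<Rightarrow> real" where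
  "Lam p = integral {0..pi} (\<lambda>\<xi>. poly p (2 * cos \<xi>) * weight \<xi>)"

lemma Lam_integrable: "(\<lambda>\<xi>. poly p (2 * cos \<xi>) * weight \<xi>) integrable_on {0..pi}"
  by (intro integrable_continuous_real continuous_intros)

text \<open>A polynomial that vanishes at 2 cos \<xi> for all \<xi> in (0, pi) is therefore 0. This
  gives definiteness of the functional, uniqueness of b_l and the recurrence of the q_l.\<close>

lemma infinite_cos_interval: "infinite ((\<lambda>\<xi>. 2 * cos \<xi>) ` {0<..<pi})"
proof -
  have "inj_on (\<lambda>\<xi>. 2 * cos \<xi>) {0<..<pi}"
    by (auto simp: inj_on_def intro: cos_inj_pi)
  moreover have "infinite {0<..<pi}"
    by simp
  ultimately show ?thesis using finite_imageD by blast
qed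

sublocale pos_def_functional Lam
proof
  show "Lam (p + q) = Lam p + Lam q" for p q
    unfolding Lam_def by (simp add: distrib_right integral_add Lam_integrable)
  show "Lam (Polynomial.smult a p) = a * Lam p" for a p
    unfolding Lam_def by (simp add: mult.assoc)
  show "Lam (p * p) > 0" if "p \<noteq> 0" for p
  proof (rule ccontr)
    have nn: "poly (p * p) (2 * cos \<xi>) * weight \<xi> \<ge> 0" for \<xi>
      using weight_nonneg by simp
    then have "Lam (p * p) \<ge> 0"
      unfolding Lam_def by (intro Henstock_Kurzweil_Integration.integral_nonneg Lam_integrable) auto
    moreover assume "\<not> Lam (p * p) > 0"
    ultimately have "Lam (p * p) = 0" by simp
    then have *: "\<forall>\<xi>\<in>{0..pi}. poly (p * p) (2 * cos \<xi>) * weight \<xi> = 0"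
      unfolding Lam_def
      by (subst (asm) integral_eq_0_iff) (use nn in \<open>auto intro!: continuous_intros simp del: poly_mult\<close>)
    have "(\<lambda>\<xi>. 2 * cos \<xi>) ` {0<..<pi} \<subseteq> {x. poly p x = 0}"
    proof safe
      fix \<xi> :: real assume "\<xi> \<in> {0<..<pi}"
      then show "poly p (2 * cos \<xi>) = 0"
        using bspec[OF *, of \<xi>] weight_pos[of \<xi>] by auto
    qed
    then show False
      using infinite_cos_interval poly_roots_finite[OF that] finite_subset by blast
  qed
qed

lemma bs_ip_poly:
  "bs_ip d ep em \<alpha> (\<lambda>\<xi>. poly p (2 * cos \<xi>)) (\<lambda>\<xi>. poly q (2 * cos \<xi>)) = Lam (p * q)"
proof -
  let ?f = "\<lambda>\<xi>. poly (p * q) (2 * cos \<xi>) * weight \<xi>"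
  have "set_integrable lborel {0..pi} ?f"
    by (intro borel_integrable_atLeastAtMost' continuous_intros)
  then have "set_integrable lborel {0<..<pi} ?f"
    by (rule set_integrable_subset) auto
  then have "(LINT \<xi>:{0<..<pi}|lborel. ?f \<xi>) = integral {0<..<pi} ?f"
    by (rule set_borel_integral_eq_integral)
  then show ?thesis
    by (simp add: bs_ip_def Lam_def bs_w_eq integral_open_interval_real)
qed

text \<open>On the circle, conjugation is z \<mapsto> 1/z, so |c|^2 = c(\<xi>) c(-\<xi>) and the
  weight cancels the factor c in each term of q_l. \<open>E (cis \<xi>)\<close> is
  1/c(-\<xi>).\<close>

lemma rpoly_weight:
  assumes "\<xi> \<in> {0<..<pi}"
  defines "E \<equiv> \<lambda>u. den (inverse u) / num u"
  shows "complex_of_real (poly (rpoly (int l)) (2 * cos \<xi>) * weight \<xi>) =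
     (cis \<xi> ^ l * E (cis \<xi>) + cis (- \<xi>) ^ l * E (cis (- \<xi>))) / (2 * of_real pi)"
proof -
  define z where "z = cis \<xi>"
  have z: "z \<noteq> 0" "den z \<noteq> 0" "inverse z = cis (- \<xi>)" "cnj z = inverse z" "cmod z = 1"
    using cis_generic[OF assms(1)] by (auto simp: z_def cis_cnj)
  have nz: "num z \<noteq> 0" "num (inverse z) \<noteq> 0" "den (inverse z) \<noteq> 0"
    using z bs_den_inverse[OF ep_em z(1)] by (auto intro!: num_nonzero simp: norm_inverse simp del: cis_inverse)
  have 1: "complex_of_real (2 * cos \<xi>) = z + inverse z"
    by (simp add: z_def complex_eq_iff)
  have "complex_of_real (weight \<xi>) = (den z * den (inverse z)) / (2 * of_real pi * (num z * num (inverse z)))"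
  proof -
    have "of_real ((cmod (den z))\<^sup>2) = den z * den (inverse z)"
      unfolding complex_norm_square den_cnj[symmetric] z(4) ..
    moreover have "of_real ((cmod (num (inverse z)))\<^sup>2) = num z * num (inverse z)"
      unfolding complex_norm_square num_cnj[symmetric] z(4)[symmetric] complex_cnj_cnj by (rule mult.commute)
    ultimately show ?thesis
      unfolding weight_def z_def[symmetric] z(3)[symmetric] of_real_divide of_real_mult by simp
  qed
  moreover have "complex_of_real (poly (rpoly (int l)) (2 * cos \<xi>)) =
      num (inverse z) / den z * z powi (int l) + num z / den (inverse z) * z powi (- int l)"
    unfolding ceval_of_real[symmetric] 1 rpoly_kernel[OF z(1,2)] by simp
  moreover have "z powi (- int l) = inverse z ^ l"
    by (simp add: power_int_minus power_inverse)
  ultimately show ?thesis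
  proof -
    have "(N' / D * Z + N / D' * Z') * (D * D' / (p * (N * N'))) = (Z * (D' / N) + Z' * (D / N')) / p"
      if "N \<noteq> 0" "N' \<noteq> 0" "D \<noteq> 0" "D' \<noteq> 0" "p \<noteq> 0" for N N' D D' Z Z' p :: complex
      using that by (simp add: divide_simps)
    from this[OF nz(1,2) z(2) nz(3), of "2 * of_real pi"] show ?thesis
      unfolding E_def z_def[symmetric] z(3)[symmetric] of_real_mult inverse_inverse_eq
      using \<open>complex_of_real (weight \<xi>) = _\<close> \<open>complex_of_real (poly (rpoly (int l)) (2 * cos \<xi>)) = _\<close>
        \<open>z powi (- int l) = _\<close> by simp
  qed
qed

lemma Lam_rpoly_cos_poly:
  assumes "k \<le> l"
  shows "Lam (rpoly (int l) * cos_poly k) = (if k = l then 1 else 0)"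
proof -
  define E where "E = (\<lambda>u. den (inverse u) / num u)"
  \<comment> \<open>On the circle z^l (z^k + z^{-k}) = z^{l-k} (z^{2k} + 1), holomorphic as k \<le>
    l; \<open>cos_poly 0\<close> is 1 and not 2, whence the case distinction. The value at 0 is E(0)
    = 1 if k = l and 0 otherwise.\<close>
  define \<Phi> where "\<Phi> = (\<lambda>u. u ^ (l - k) * (if k = 0 then 1 else u ^ (2 * k) + 1) * E u)"
  have E_alt: "E u = ((1 + of_nat ep * u) * (1 - of_nat em * u)) / num u" for u
    by (simp add: E_def bs_den_def)
  have holE: "E holomorphic_on ball 0 1"
    unfolding E_alt[abs_def] num_def
    by (intro holomorphic_intros) (use num_nonzero in \<open>auto simp: num_def\<close>)
  have contE: "continuous_on (cball 0 1) E"
    unfolding E_alt[abs_def] num_def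
    by (intro continuous_intros) (use num_nonzero in \<open>auto simp: num_def\<close>)
  have "((\<lambda>t. \<Phi> (cis t)) has_integral (2 * of_real pi * \<Phi> 0)) {0..2 * pi}"
  proof (rule mean_value_circle)
    have "continuous_on A (\<lambda>u::complex. if k = 0 then 1 else u ^ (2 * k) + 1)"
        "(\<lambda>u. if k = 0 then 1 else u ^ (2 * k) + 1) holomorphic_on A" for A
      by (cases "k = 0"; simp; intro continuous_intros holomorphic_intros)+
    then show "continuous_on (cball 0 1) \<Phi>" "\<Phi> holomorphic_on ball 0 1"
      unfolding \<Phi>_def by (intro continuous_intros holomorphic_intros contE holE; simp)+
  qed
  from integral_0_2pi_fold[OF this]
  have *: "((\<lambda>t. \<Phi> (cis t) + \<Phi> (cis (2 * pi - t))) has_integral (2 * of_real pi * \<Phi> 0)) {0..pi}" .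
  have c2: "cis (2 * pi - t) = cis (- t)" for t
    by (simp add: complex_eq_iff cos_diff sin_diff)
  have C: "cis t ^ l * complex_of_real (poly (cos_poly k) (2 * cos t)) =
      cis t ^ (l - k) * (if k = 0 then 1 else cis t ^ (2 * k) + 1)" for t
  proof (cases "k = 0")
    case False
    have "complex_of_real (poly (cos_poly k) (2 * cos t)) = cis t ^ k + inverse (cis t ^ k)"
      using False unfolding Complex.DeMoivre by (simp add: cos_poly_def hpoly_cos complex_eq_iff)
    moreover have "cis t ^ l = cis t ^ (l - k) * cis t ^ k"
      using assms by (simp flip: power_add)
    ultimately have "cis t ^ l * complex_of_real (poly (cos_poly k) (2 * cos t)) =
        cis t ^ (l - k) * cis t ^ k * (cis t ^ k + inverse (cis t ^ k))"
      by (simp only:)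
    also have "\<dots> = cis t ^ (l - k) * (cis t ^ k * cis t ^ k + 1)"
    proof -
      have *: "x * c * (c + inverse c) = x * (c * c + 1)" if "c \<noteq> 0" for x c :: complex
        using that by (simp add: field_simps)
      show ?thesis by (rule *) simp
    qed
    also have "cis t ^ k * cis t ^ k = cis t ^ (2 * k)"
      by (simp only: mult_2 power_add)
    finally show ?thesis using False by (simp only: if_False)
  qed (simp add: cos_poly_def)
  have "((\<lambda>t. complex_of_real (2 * pi * (poly (rpoly (int l) * cos_poly k) (2 * cos t) * weight t)))
      has_integral (2 * of_real pi * \<Phi> 0)) {0..pi}"
  \<comment> \<open>The endpoints are exempted because c may have poles there.\<close>
  proof (rule has_integral_spike_finite[OF _ _ *])
    fix t assume "t \<in> {0..pi} - {0, pi}"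
    then have t: "t \<in> {0<..<pi}" by auto
    have "complex_of_real (2 * pi * (poly (rpoly (int l) * cos_poly k) (2 * cos t) * weight t)) =
      2 * of_real pi * of_real (poly (rpoly (int l)) (2 * cos t) * weight t) * of_real (poly (cos_poly k) (2 * cos t))"
      by simp
    also have "\<dots> = (cis t ^ l * E (cis t) + cis (- t) ^ l * E (cis (- t))) * of_real (poly (cos_poly k) (2 * cos t))"
      unfolding rpoly_weight[OF t] E_def by simp
    also have "\<dots> = \<Phi> (cis t) + \<Phi> (cis (- t))"
    proof -
      have aux: "(x * e + x' * e') * p = (x * p) * e + (x' * p) * e'" for x x' e e' p :: complex
        by (simp add: algebra_simps)
      have "cis (- t) ^ l * complex_of_real (poly (cos_poly k) (2 * cos t)) =
          cis (- t) ^ (l - k) * (if k = 0 then 1 else cis (- t) ^ (2 * k) + 1)"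
        using C[of "- t"] by (simp only: cos_minus)
      then show ?thesis by (simp only: aux C \<Phi>_def)
    qed
    finally show "complex_of_real (2 * pi * (poly (rpoly (int l) * cos_poly k) (2 * cos t) * weight t)) =
      \<Phi> (cis t) + \<Phi> (cis (2 * pi - t))" by (simp add: c2)
  qed simp
  moreover have "((\<lambda>t. complex_of_real (2 * pi * (poly (rpoly (int l) * cos_poly k) (2 * cos t) * weight t)))
      has_integral (of_real (2 * pi * Lam (rpoly (int l) * cos_poly k)))) {0..pi}"
    unfolding Lam_def
    by (intro has_integral_of_real has_integral_mult_right integrable_integral Lam_integrable)
  ultimately have "complex_of_real (2 * pi * Lam (rpoly (int l) * cos_poly k)) = 2 * of_real pi * \<Phi> 0"
    using has_integral_unique by blast
  also have "\<Phi> 0 = of_real (if k = l then 1 else 0)"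
    using assms by (auto simp: \<Phi>_def E_alt num_def)
  finally have "complex_of_real (Lam (rpoly (int l) * cos_poly k)) = of_real (if k = l then 1 else 0)"
    by simp
  then show ?thesis by (simp only: of_real_eq_iff)
qed

lemma rpoly_eq_opoly:
  assumes "real l \<ge> d_eps d ep em"
  shows "rpoly (int l) = Polynomial.smult (1 / \<delta> l) (opoly l)"
  by (rule opoly_unique) (simp_all add: coeff_rpoly_above assms Lam_rpoly_cos_poly)

lemma \<delta>_eq_1:
  assumes "real l > d_eps d ep em"
  shows "\<delta> l = 1"
  using rpoly_eq_opoly[of l] coeff_rpoly_top[of l] assms by simp

section \<open>Identification of the Gram-Schmidt data with the algebraic ones\<close>

lemma bs_p_eq: "bs_p d ep em \<alpha> l \<xi> = poly (opoly l) (2 * cos \<xi>)"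
proof -
  have "gs_orth (bs_ip d ep em \<alpha>) cos_mono l = (\<lambda>\<xi>. poly (opoly l) (2 * cos \<xi>))"
  proof (induction l rule: less_induct)
    case (less l)
    have "cos_mono l = (\<lambda>\<xi>. poly (cos_poly l) (2 * cos \<xi>))"
      by (auto simp: cos_mono_poly)
    then show ?case
      by (subst gs_orth.simps, subst opoly.simps) (auto simp: less.IH bs_ip_poly poly_sum intro!: sum.cong ext)
  qed
  then show ?thesis by (simp add: bs_p_def)
qed

lemma bs_Delta_eq: "bs_Delta d ep em \<alpha> l = \<delta> l"
  using bs_ip_poly[of "opoly l" "opoly l"]
  by (simp add: bs_Delta_def bs_p_eq \<delta>_def bs_ip_def power2_eq_square)

lemma bs_a_sq: "(bs_a d ep em \<alpha> (Suc l))\<^sup>2 = \<delta> (Suc l) / \<delta> l"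
  using \<delta>_pos[of l] \<delta>_pos[of "Suc l"] by (simp add: bs_a_def bs_Delta_eq)

text \<open>Dividing the monic recurrence by \<open>\<delta> l\<close> gives that of the normalized
  polynomials and moves the quotient of norms to the upper neighbour. Uniqueness of the coefficient
  needs a point where p_l does not vanish.\<close>

lemma bs_b_eq: "bs_b d ep em \<alpha> l = \<beta> l"
proof -
  have rec: "2 * cos \<xi> * bs_pn d ep em \<alpha> l \<xi> =
        (if l = 0 then 0 else bs_pn d ep em \<alpha> (l - 1) \<xi>) + \<beta> l * bs_pn d ep em \<alpha> l \<xi> +
        (bs_a d ep em \<alpha> (l + 1))\<^sup>2 * bs_pn d ep em \<alpha> (l + 1) \<xi>" for \<xi>
    using arg_cong[OF opoly_rec[of l], of "\<lambda>p. poly p (2 * cos \<xi>) / \<delta> l"]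
    by (auto simp: bs_pn_def bs_p_eq bs_Delta_eq bs_a_sq field_simps)
  have "\<exists>\<xi>. bs_pn d ep em \<alpha> l \<xi> \<noteq> 0"
  proof (rule ccontr)
    assume "\<not> (\<exists>\<xi>. bs_pn d ep em \<alpha> l \<xi> \<noteq> 0)"
    then have "(\<lambda>\<xi>. 2 * cos \<xi>) ` {0<..<pi} \<subseteq> {x. poly (opoly l) x = 0}"
      by (auto simp: bs_pn_def bs_p_eq bs_Delta_eq)
    then show False
      using infinite_cos_interval poly_roots_finite[OF opoly_nonzero] finite_subset by blast
  qed
  then obtain \<xi>0 where nz: "bs_pn d ep em \<alpha> l \<xi>0 \<noteq> 0" by blast
  show ?thesis
    unfolding bs_b_def
  proof (rule the_equality)
    fix b
    assume "\<forall>\<xi>. 2 * cos \<xi> * bs_pn d ep em \<alpha> l \<xi> =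
        (if l = 0 then 0 else bs_pn d ep em \<alpha> (l - 1) \<xi>) + b * bs_pn d ep em \<alpha> l \<xi> +
        (bs_a d ep em \<alpha> (l + 1))\<^sup>2 * bs_pn d ep em \<alpha> (l + 1) \<xi>"
    then have "b * bs_pn d ep em \<alpha> l \<xi>0 = \<beta> l * bs_pn d ep em \<alpha> l \<xi>0"
      using rec[of \<xi>0] by (metis add_left_cancel add_right_cancel)
    then show "b = \<beta> l" using nz by simp
  qed (use rec in blast)
qed

section \<open>Indices at which the recurrence has constant coefficients\<close>

lemma rpoly_rec: "[:0, 1:] * rpoly l = rpoly (l + 1) + rpoly (l - 1)"
proof -
  have *: "[:0, 1:] * hpolyZ ep em n = hpolyZ ep em (n + 1) + hpolyZ ep em (n - 1)" for n
  proof -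
    let ?g = "[:0, 1:] * hpolyZ ep em n - (hpolyZ ep em (n + 1) + hpolyZ ep em (n - 1))"
    have "(\<lambda>\<xi>. 2 * cos \<xi>) ` {0<..<pi} \<subseteq> {x. poly ?g x = 0}"
    proof safe
      fix \<xi> :: real assume \<xi>: "\<xi> \<in> {0<..<pi}"
      have z: "cis \<xi> \<noteq> 0" "den (cis \<xi>) \<noteq> 0"
        using cis_generic[OF \<xi>] by auto
      have 1: "complex_of_real (2 * cos \<xi>) = cis \<xi> + inverse (cis \<xi>)"
        by (simp add: complex_eq_iff)
      have "complex_of_real (poly ?g (2 * cos \<xi>)) = 0"
        unfolding ceval_of_real[symmetric] 1
        using hker_rec[of "cis \<xi>" ep em n] hker_eq_hpolyZ[OF ep_em z]
        by (simp add: algebra_simps)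
      then show "poly ?g (2 * cos \<xi>) = 0" by (simp only: of_real_eq_0_iff)
    qed
    then have "?g = 0"
      using infinite_cos_interval poly_roots_finite finite_subset by blast
    then show ?thesis by simp
  qed
  have "[:0, 1:] * rpoly l = (\<Sum>k\<le>d. Polynomial.smult (Re (elem_sym d \<alpha> (int k))) ([:0, 1:] * hpolyZ ep em (l - int k)))"
    unfolding rpoly_def by (simp add: sum_distrib_left)
  then show ?thesis
    unfolding * rpoly_def by (simp add: sum.distrib smult_add_right algebra_simps)
qed

text \<open>The bound leaves only d = 0 and ep = em = 1, where q_{-1} is the second-kind Chebyshev
  polynomial U_{-1} = 0. It stands for the missing neighbour of index 0.\<close>

lemma rpoly_minus_1:
  assumes "d_eps d ep em \<le> - 1"
  shows "rpoly (- 1) = 0"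
proof -
  have "d = 0" "ep = 1" "em = 1"
    using assms ep_em by (auto simp: d_eps_def)
  then have "hpolyZ ep em (- 1 - int k) = 0" if "k \<le> d" for k
    using that by (simp add: hpolyZ_def)
  then show ?thesis by (simp add: rpoly_def)
qed

text \<open>The recurrence of the q_l has no diagonal term, and it transfers once q_{l-1}, q_l,
  q_{l+1} are all multiples of orthogonal polynomials; hence the bound d_eps + 1. The norm
  \<open>\<delta> (l - 1)\<close> may still differ from 1, but its inverse is exactly the scalar
  contained in q_{l-1}.\<close>

lemma \<beta>_eq_0:
  assumes "real l \<ge> d_eps d ep em + 1"
  shows "\<beta> l = 0"
proof -
  have "\<delta> l = 1" "\<delta> (Suc l) = 1"
    using assms by (auto intro!: \<delta>_eq_1)
  moreover have "rpoly (int l) = Polynomial.smult (1 / \<delta> l) (opoly l)"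
      "rpoly (int (Suc l)) = Polynomial.smult (1 / \<delta> (Suc l)) (opoly (Suc l))"
    using assms by (intro rpoly_eq_opoly; simp)+
  moreover have "rpoly (int l - 1) = (if l = 0 then 0 else Polynomial.smult (\<delta> l / \<delta> (l - 1)) (opoly (l - 1)))"
  proof (cases l)
    case 0
    then show ?thesis using rpoly_minus_1 assms by simp
  next
    case (Suc k)
    then show ?thesis using rpoly_eq_opoly[of k] assms \<open>\<delta> l = 1\<close> by simp
  qed
  ultimately have "Polynomial.smult (\<beta> l) (opoly l) = 0"
    using opoly_rec[of l] rpoly_rec[of "int l"] by (simp add: algebra_simps split: if_splits)
  then show ?thesis by simp
qed

end

section \<open>Tridiagonal determinants\<close>

definition tridiag ::
    "nat \<Rightarrow> (nat \<Rightarrow> 'a) \<Rightarrow> (nat \<Rightarrow> 'a) \<Rightarrow> (nat \<Rightarrow> 'a) \<Rightarrow> 'a :: comm_ring_1 Matrix.mat" where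
  "tridiag n a u v = Matrix.mat n n (\<lambda>(i, j).
     if i = j then a i else if j = Suc i then u i else if i = Suc j then v j else 0)"

lemma tridiag_carrier [simp]: "tridiag n a u v \<in> carrier_mat n n"
  by (simp add: tridiag_def)

lemma det_tridiag_0: "Determinant.det (tridiag 0 a u v) = 1"
  by (rule det_dim_zero) simp

lemma det_tridiag_1: "Determinant.det (tridiag (Suc 0) a u v) = a 0"
  by (subst det_single) (simp_all add: tridiag_def)

text \<open>Expansion along the last row; the minor of the off-diagonal entry is then expanded along
  its last column.\<close>

lemma det_tridiag_Suc_Suc:
  "Determinant.det (tridiag (Suc (Suc n)) a u v) =
     a (Suc n) * Determinant.det (tridiag (Suc n) a u v) - u n * v n * Determinant.det (tridiag n a u v)"
proof -
  let ?A = "tridiag (Suc (Suc n)) a u v"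
  let ?B = "mat_delete ?A (Suc n) n"
  have B: "?B \<in> carrier_mat (Suc n) (Suc n)"
    using mat_delete_carrier[OF tridiag_carrier[of "Suc (Suc n)" a u v]] by simp
  have "Determinant.det ?B = (\<Sum>i<Suc n. ?B $$ (i, n) * cofactor ?B i n)"
    by (rule laplace_expansion_column[OF B]) simp
  also have "\<dots> = (\<Sum>i<Suc n. if i = n then u n * cofactor ?B n n else 0)"
    by (intro sum.cong) (auto simp: mat_delete_def tridiag_def)
  also have "\<dots> = u n * Determinant.det (tridiag n a u v)"
  proof -
    have "mat_delete ?B n n = tridiag n a u v"
      by (rule eq_matI) (auto simp: mat_delete_def tridiag_def)
    then show ?thesis by (simp add: cofactor_def)
  qed
  finally have dB: "Determinant.det ?B = u n * Determinant.det (tridiag n a u v)" .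
  have dC: "mat_delete ?A (Suc n) (Suc n) = tridiag (Suc n) a u v"
    by (rule eq_matI) (auto simp: mat_delete_def tridiag_def)
  have "Determinant.det ?A = (\<Sum>j<Suc (Suc n). ?A $$ (Suc n, j) * cofactor ?A (Suc n) j)"
    by (rule laplace_expansion_row) auto
  also have "\<dots> = (\<Sum>j<n. ?A $$ (Suc n, j) * cofactor ?A (Suc n) j) + v n * cofactor ?A (Suc n) n + a (Suc n) * cofactor ?A (Suc n) (Suc n)"
    by (simp add: tridiag_def)
  also have "(\<Sum>j<n. ?A $$ (Suc n, j) * cofactor ?A (Suc n) j) = 0"
    by (intro sum.neutral) (auto simp: tridiag_def)
  finally show ?thesis
    by (simp add: cofactor_def dB dC algebra_simps)
qed

text \<open>Here \<open>D n\<close> stands for the leading minors and \<open>P k\<close> for the trailing minors of size \<open>k\<close>.\<close>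

lemma continuant_split:
  fixes D P a w :: "nat \<Rightarrow> 'a :: comm_ring_1"
  assumes D: "D 0 = 1" "D 1 = a 0" "\<And>n. D (Suc (Suc n)) = a (Suc n) * D (Suc n) - w n * D n"
    and P: "P 0 = 1" "K > 0 \<Longrightarrow> P 1 = a m" "\<And>k. Suc k < K \<Longrightarrow> P (Suc (Suc k)) = a (m - Suc k) * P (Suc k) - w (m - Suc k) * P k"
    and "k \<le> K" "K \<le> Suc m"
  shows "D (Suc m) = D (Suc m - k) * P k - (if k = 0 \<or> k = Suc m then 0 else w (m - k) * D (m - k) * P (k - 1))"
  using \<open>k \<le> K\<close>
proof (induction k)
  case 0
  then show ?case using P by simp
next
  case (Suc k)
  then have IH: "D (Suc m) = D (Suc (m - k)) * P k - (if k = 0 then 0 else w (m - k) * D (m - k) * P (k - 1))"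
    using \<open>K \<le> Suc m\<close> by (auto simp: Suc_diff_le)
  have Psuc: "P (Suc k) = a (m - k) * P k - (if k = 0 then 0 else w (m - k) * P (k - 1))"
    using P Suc.prems by (cases k) auto
  show ?case
  proof (cases "m - k")
    case 0
    then have "m = k" using Suc.prems \<open>K \<le> Suc m\<close> by simp
    then show ?thesis using IH[unfolded \<open>m = k\<close> diff_self_eq_0] Psuc[unfolded \<open>m = k\<close> diff_self_eq_0] D(1,2)
      by (cases "k = 0") simp_all
  next
    case (Suc n)
    then have m: "m - Suc k = n" "m \<noteq> k" by auto
    \<comment> \<open>Row \<open>Suc n\<close> changes sides: expanding
      \<open>D (Suc (Suc n))\<close> along it, its diagonal term and \<open>c\<close> reassemble to
      the longer trailing minor.\<close>
    define c where "c = (if k = 0 then 0 else w (Suc n) * P (k - 1))"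
    have "D (Suc m) = D (Suc (Suc n)) * P k - D (Suc n) * c" "P (Suc k) = a (Suc n) * P k - c"
      using IH Psuc by (auto simp: Suc c_def)
    then have "D (Suc m) = D (Suc n) * P (Suc k) - w n * D n * P k"
      by (simp add: D(3) right_diff_distrib left_diff_distrib mult_ac)
    then show ?thesis using m by (simp add: Suc)
  qed
qed

section \<open>The characteristic polynomial\<close>

locale bs_pair = left: bs_family d ep em \<alpha> + right: bs_family d' ep' em' \<alpha>'
  for d ep em \<alpha> d' ep' em' \<alpha>' +
  fixes m :: nat
  assumes m_large: "int m > \<lceil>d_eps d ep em\<rceil> + \<lceil>d_eps d' ep' em'\<rceil>"
begin

lemma ceiling_ge: "\<lceil>d_eps d ep em\<rceil> \<ge> - 1" "\<lceil>d_eps d' ep' em'\<rceil> \<ge> - 1"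
  using left.ep_em right.ep_em by (auto simp: d_eps_def le_ceiling_iff)

text \<open>The \<open>K\<close> last rows of the matrix carry the coefficients with tildes, the first \<open>n0\<close> rows
  those without; the constant rows in the middle fit either pattern.\<close>

definition K :: nat where "K = nat (\<lceil>d_eps d' ep' em'\<rceil> + 1)"
definition n0 :: nat where "n0 = Suc m - K"

text \<open>The size of \<open>m\<close> leaves the first block enough rows, so that on both sides
  of the cut the neighbouring q are multiples of orthogonal polynomials.\<close>

lemma K_le: "K \<le> Suc m" and n0_K: "n0 + K = Suc m" and int_K: "int K = \<lceil>d_eps d' ep' em'\<rceil> + 1"
  and int_n0: "int n0 = int m - \<lceil>d_eps d' ep' em'\<rceil>" and n0_ge: "int n0 \<ge> \<lceil>d_eps d ep em\<rceil> + 1"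
  using m_large ceiling_ge by (auto simp: K_def n0_def)

lemma n0_bounds: "real n0 > d_eps d ep em" "real n0 \<ge> d_eps d ep em + 1" "n0 = 0 \<Longrightarrow> d_eps d ep em \<le> - 1"
  and K_bounds: "real K > d_eps d' ep' em'" "real K \<ge> d_eps d' ep' em' + 1" "K = 0 \<Longrightarrow> d_eps d' ep' em' \<le> - 1"
proof -
  show "real n0 \<ge> d_eps d ep em + 1" "real K \<ge> d_eps d' ep' em' + 1"
    using n0_ge int_K by linarith+
  then show "real n0 > d_eps d ep em" "real K > d_eps d' ep' em'"
      "n0 = 0 \<Longrightarrow> d_eps d ep em \<le> - 1" "K = 0 \<Longrightarrow> d_eps d' ep' em' \<le> - 1"
    by auto
qed

definition diag :: "nat \<Rightarrow> real" where
  "diag l = (if l < n0 then left.\<beta> l else right.\<beta> (m - l))"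

definition upper :: "nat \<Rightarrow> real" where
  "upper l = (if l < n0 then left.\<delta> (Suc l) / left.\<delta> l else 1)"

text \<open>Indexed by the column: \<open>lower l\<close> sits in row \<open>Suc l\<close>, hence
  the test on \<open>Suc l\<close>.\<close>

definition lower :: "nat \<Rightarrow> real" where
  "lower l = (if Suc l < n0 then 1 else right.\<delta> (m - l) / right.\<delta> (m - Suc l))"

lemma bs_L_tridiag: "bs_L d ep em \<alpha> d' ep' em' \<alpha>' m = tridiag (Suc m) diag upper lower"
proof (rule eq_matI)
  fix l k
  assume "l < dim_row (tridiag (Suc m) diag upper lower)" "k < dim_col (tridiag (Suc m) diag upper lower)"
  then have lk: "l \<le> m" "k \<le> m" by (auto simp: tridiag_def)
  have kdelta: "kdelta (int l - int k) = (if l = k then 1 else 0)"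
      "kdelta (int l - int k - 1) = (if l = Suc k then 1 else 0)"
      "kdelta (int l - int k + 1) = (if k = Suc l then 1 else 0)"
    by (auto simp: kdelta_def)
  consider "int l \<le> \<lceil>d_eps d ep em\<rceil>" | "int l > \<lceil>d_eps d ep em\<rceil>" "l < n0" | "int l > \<lceil>d_eps d ep em\<rceil>" "l \<ge> n0"
    by linarith
  then show "bs_L d ep em \<alpha> d' ep' em' \<alpha>' m $$ (l, k) = tridiag (Suc m) diag upper lower $$ (l, k)"
  proof cases
    case 1
    then have "l < n0" using n0_ge by linarith
    then show ?thesis using 1 lk
      by (auto simp: bs_L_def tridiag_def kdelta diag_def upper_def lower_def left.bs_a_sq left.bs_b_eq)
  next
    case 2
    \<comment> \<open>A constant row above the cut is a row of the first family whose coefficients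
      have already stabilised.\<close>
    then have "left.\<beta> l = 0" "left.\<delta> l = 1" "left.\<delta> (Suc l) = 1"
      by (intro left.\<beta>_eq_0 left.\<delta>_eq_1; linarith)+
    then show ?thesis using 2 lk int_n0
      by (auto simp: bs_L_def tridiag_def kdelta diag_def upper_def lower_def)
  next
    case 3
    then have "(bs_a d' ep' em' \<alpha>' (m - l + 1))\<^sup>2 = right.\<delta> (Suc m - l) / right.\<delta> (m - l)"
      using right.bs_a_sq[of "m - l"] lk by (simp add: Suc_diff_le)
    then show ?thesis using 3 lk int_n0 n0_ge
      by (auto simp: bs_L_def tridiag_def kdelta diag_def upper_def lower_def right.bs_b_eq Suc_diff_Suc)
  qed
qed (auto simp: bs_L_def tridiag_def)

text \<open>A discrete Wronskian of the two families at the cut. The first product is monic and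
  matches the minors; the second is written with q, which makes sense at index -1 when a block is
  empty.\<close>

definition W :: "real poly" where
  "W = left.opoly n0 * right.opoly K - left.rpoly (int n0 - 1) * right.rpoly (int K - 1)"

lemma W_alt:
  "W = left.opoly n0 * right.opoly K -
     (if K = 0 \<or> n0 = 0 then 0 else
        Polynomial.smult (1 / left.\<delta> (n0 - 1) * (1 / right.\<delta> (K - 1))) (left.opoly (n0 - 1) * right.opoly (K - 1)))"
proof (cases "K = 0 \<or> n0 = 0")
  case True
  then show ?thesis
    using n0_bounds K_bounds left.rpoly_minus_1 right.rpoly_minus_1 by (auto simp: W_def)
next
  case False
  have "real (n0 - 1) \<ge> d_eps d ep em" "real (K - 1) \<ge> d_eps d' ep' em'"
    using False n0_bounds K_bounds by (auto simp: of_nat_diff)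
  then have "left.rpoly (int (n0 - 1)) = Polynomial.smult (1 / left.\<delta> (n0 - 1)) (left.opoly (n0 - 1))"
      "right.rpoly (int (K - 1)) = Polynomial.smult (1 / right.\<delta> (K - 1)) (right.opoly (K - 1))"
    by (intro left.rpoly_eq_opoly right.rpoly_eq_opoly; simp)+
  then show ?thesis
    using False by (simp add: W_def of_nat_diff mult.commute)
qed

lemma W_rpoly: "W = left.rpoly (int n0) * right.rpoly (int K) - left.rpoly (int n0 - 1) * right.rpoly (int K - 1)"
  using n0_bounds K_bounds
  by (simp add: W_def left.rpoly_eq_opoly right.rpoly_eq_opoly left.\<delta>_eq_1 right.\<delta>_eq_1)

lemma degree_W: "degree W = Suc m" and lead_coeff_W: "Polynomial.coeff W (Suc m) = 1"
proof -
  let ?r = "if K = 0 \<or> n0 = 0 then 0 else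
        Polynomial.smult (1 / left.\<delta> (n0 - 1) * (1 / right.\<delta> (K - 1))) (left.opoly (n0 - 1) * right.opoly (K - 1))"
  have r: "degree ?r < Suc m"
    using n0_K by (auto simp: degree_mult_eq)
  have "degree (left.opoly n0 * right.opoly K) = Suc m"
    using n0_K by (simp add: degree_mult_eq)
  moreover from this have "Polynomial.coeff (left.opoly n0 * right.opoly K) (Suc m) = 1"
    by (metis lead_coeff_mult left.coeff_opoly_top right.coeff_opoly_top left.degree_opoly right.degree_opoly mult_1)
  ultimately show "degree W = Suc m" "Polynomial.coeff W (Suc m) = 1"
    unfolding W_alt using r coeff_eq_0[OF r] degree_add_eq_left[of "- ?r" "left.opoly n0 * right.opoly K"]
    by (simp_all only: coeff_diff diff_conv_add_uminus degree_minus) simp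
qed

lemma det_L:
  "Determinant.det (x \<cdot>\<^sub>m 1\<^sub>m (Suc m) - map_mat complex_of_real (bs_L d ep em \<alpha> d' ep' em' \<alpha>' m)) = ceval W x"
proof -
  define a where "a = (\<lambda>l. x - of_real (diag l))"
  define u where "u = (\<lambda>l. - complex_of_real (upper l))"
  define v where "v = (\<lambda>l. - complex_of_real (lower l))"
  define w where "w = (\<lambda>l. u l * v l)"
  define D where "D = (\<lambda>n. Determinant.det (tridiag n a u v))"
  have mat: "x \<cdot>\<^sub>m 1\<^sub>m (Suc m) - map_mat complex_of_real (bs_L d ep em \<alpha> d' ep' em' \<alpha>' m) = tridiag (Suc m) a u v"
    unfolding bs_L_tridiag by (rule eq_matI) (auto simp: tridiag_def a_def u_def v_def)
  have D0: "D 0 = 1" and D1: "D 1 = a 0"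
    and D2: "\<And>n. D (Suc (Suc n)) = a (Suc n) * D (Suc n) - w n * D n"
    by (simp_all add: D_def det_tridiag_0 det_tridiag_1 det_tridiag_Suc_Suc w_def)
  have left_rec: "ceval (left.opoly (Suc n)) x = (x - of_real (left.\<beta> n)) * ceval (left.opoly n) x -
      (if n = 0 then 0 else of_real (left.\<delta> n / left.\<delta> (n - 1)) * ceval (left.opoly (n - 1)) x)" for n
    using arg_cong[OF left.opoly_rec[of n], of "\<lambda>p. ceval p x"] by (auto simp: algebra_simps)
  have right_rec: "ceval (right.opoly (Suc n)) x = (x - of_real (right.\<beta> n)) * ceval (right.opoly n) x -
      (if n = 0 then 0 else of_real (right.\<delta> n / right.\<delta> (n - 1)) * ceval (right.opoly (n - 1)) x)" for n
    using arg_cong[OF right.opoly_rec[of n], of "\<lambda>p. ceval p x"] by (auto simp: algebra_simps)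
  have op0: "left.opoly 0 = 1" "right.opoly 0 = 1"
    by (subst left.opoly.simps right.opoly.simps, simp add: cos_poly_def)+
  have Dn: "n \<le> n0 \<Longrightarrow> D n = ceval (left.opoly n) x" for n
  proof (induction n rule: less_induct)
    case (less n)
    consider "n = 0" | "n = 1" | k where "n = Suc (Suc k)"
      by (cases n; cases "n - 1") auto
    then show ?case
    proof cases
      case 1
      then show ?thesis using D0 by (simp add: op0)
    next
      case 2
      then show ?thesis using D1 left_rec[of 0] less.prems by (simp add: op0 a_def diag_def)
    next
      case 3
      then have "Suc k < n0" using less.prems by simp
      then have "a (Suc k) = x - of_real (left.\<beta> (Suc k))" "w k = of_real (left.\<delta> (Suc k) / left.\<delta> k)"
        by (simp_all add: a_def w_def u_def v_def diag_def upper_def lower_def)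
      then show ?thesis
        using 3 D2[of k] left_rec[of "Suc k"] less.IH[of k] less.IH[of "Suc k"] less.prems by simp
    qed
  qed
  define P where "P = (\<lambda>k. ceval (right.opoly k) x)"
  have "D (Suc m) = D (Suc m - K) * P K - (if K = 0 \<or> K = Suc m then 0 else w (m - K) * D (m - K) * P (K - 1))"
  proof (rule continuant_split[where K = K and a = a])
    fix k assume k: "Suc k < K"
    have *: "n0 \<le> m - Suc k" "m - (m - Suc k) = Suc k" "m - Suc (m - Suc k) = k"
      using k n0_K by auto
    have "a (m - Suc k) = x - of_real (right.\<beta> (Suc k))" "w (m - Suc k) = of_real (right.\<delta> (Suc k) / right.\<delta> k)"
      using * by (simp_all add: a_def w_def u_def v_def diag_def upper_def lower_def)
    then show "P (Suc (Suc k)) = a (m - Suc k) * P (Suc k) - w (m - Suc k) * P k"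
      using right_rec[of "Suc k"] by (simp add: P_def)
  next
    assume "K > 0"
    then show "P 1 = a m"
      using n0_K right_rec[of 0] by (simp add: P_def op0 a_def diag_def)
  qed (use D0 D1 D2 K_le in \<open>simp_all add: P_def op0\<close>)
  then have "D (Suc m) = D n0 * P K - (if K = 0 \<or> n0 = 0 then 0 else w (n0 - 1) * D (n0 - 1) * P (K - 1))"
  proof -
    have "Suc m - K = n0" "m - K = n0 - 1" "K = Suc m \<longleftrightarrow> n0 = 0"
      using n0_K by auto
    then show ?thesis
      using \<open>D (Suc m) = D (Suc m - K) * P K - _\<close> by simp
  qed
  also have "\<dots> = ceval W x"
  proof (cases "K = 0 \<or> n0 = 0")
    case False
    have "left.\<delta> n0 = 1" "right.\<delta> K = 1"
      using n0_bounds K_bounds by (auto intro: left.\<delta>_eq_1 right.\<delta>_eq_1)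
    moreover have "m - (n0 - 1) = K" "m - n0 = K - 1"
      using n0_K False by auto
    \<comment> \<open>The two entries across the cut come from different families, each a quotient
      of norms whose numerator is 1.\<close>
    ultimately have "w (n0 - 1) = of_real (1 / left.\<delta> (n0 - 1) * (1 / right.\<delta> (K - 1)))"
      using False by (simp add: w_def u_def v_def upper_def lower_def)
    then show ?thesis using False by (simp add: W_alt Dn P_def)
  qed (auto simp: W_alt Dn P_def)
  finally show ?thesis by (simp add: D_def mat)
qed

end

section \<open>Q as a sum of a function of z and its image under z \<mapsto> 1/z\<close>

lemma isCont_eq_everywhere:
  fixes f g :: "complex \<Rightarrow> complex"
  assumes "isCont f \<xi>" "isCont g \<xi>" "\<And>w. sin w \<noteq> 0 \<Longrightarrow> f w = g w"
  shows "f \<xi> = g \<xi>"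
proof -
  have "eventually (\<lambda>w. f w = g w) (at \<xi>)"
    using eventually_sin_nonzero[of \<xi>] assms(3) by (auto elim: eventually_mono)
  moreover have "(f \<longlongrightarrow> f \<xi>) (at \<xi>)" "(g \<longlongrightarrow> g \<xi>) (at \<xi>)"
    using assms by (auto dest: isContD)
  ultimately have "(g \<longlongrightarrow> f \<xi>) (at \<xi>)"
    by (simp cong: filterlim_cong)
  with \<open>(g \<longlongrightarrow> g \<xi>) (at \<xi>)\<close> show ?thesis
    using LIM_unique by blast
qed

lemma sum_shift_index:
  fixes f :: "int \<Rightarrow> complex"
  assumes "f (- 1) = 0"
  shows "(\<Sum>k\<le>Suc n. f (int k - 1) * y ^ k) = y * (\<Sum>k\<le>n. f (int k) * y ^ k)"
  by (subst sum.atMost_Suc_shift) (simp add: assms sum_distrib_left mult_ac)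

lemma elem_sym_eta_generating:
  "(\<Sum>k\<le>d + 2. elem_sym_eta d \<alpha> hp hm (int k) * y ^ k) =
     (\<Prod>r = 1..d. 1 + \<alpha> r * y) * (1 + of_nat hp * y) * (1 - of_nat hm * y)"
proof -
  let ?e = "elem_sym d \<alpha>"
  define p where "p = (\<Sum>k\<le>d. ?e (int k) * y ^ k)"
  have 0: "(\<Sum>k\<le>d + j. ?e (int k) * y ^ k) = p" for j :: nat
    by (induction j) (simp_all add: p_def elem_sym_above)
  have 1: "(\<Sum>k\<le>d + Suc j. ?e (int k - 1) * y ^ k) = y * p" for j :: nat
    using sum_shift_index[where f = ?e and n = "d + j"] by (simp add: 0 elem_sym_neg)
  have 2: "(\<Sum>k\<le>d + 2. ?e (int k - 2) * y ^ k) = y * (y * p)"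
    using sum_shift_index[where f = "\<lambda>i. ?e (i - 1)" and n = "d + 1"] 1[of 0] by (simp add: elem_sym_neg)
  have "(\<Sum>k\<le>d + 2. elem_sym_eta d \<alpha> hp hm (int k) * y ^ k) =
      (\<Sum>k\<le>d + 2. ?e (int k) * y ^ k) + (of_nat hp - of_nat hm) * (\<Sum>k\<le>d + Suc 1. ?e (int k - 1) * y ^ k)
      - of_nat hp * of_nat hm * (\<Sum>k\<le>d + 2. ?e (int k - 2) * y ^ k)"
    by (simp only: elem_sym_eta_def distrib_right left_diff_distrib sum.distrib sum_subtractf sum_distrib_left mult.assoc)
       simp
  also have "\<dots> = p * (1 + of_nat hp * y) * (1 - of_nat hm * y)"
    by (simp only: 0 1 2) (simp add: algebra_simps)
  finally show ?thesis by (simp only: p_def prod_linear_eq_elem_sym)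
qed

context bs_pair
begin

text \<open>2 (d_eps' + 1) = d' + 2 - ep' - em' is the degree of the generating polynomial, since
  each sign equal to 1 removes one of its two extra linear factors. Beyond it the coefficients
  vanish, so one range serves all signs.\<close>

lemma bs_Q_sum:
  "bs_Q d ep em \<alpha> d' ep' em' \<alpha>' m \<xi> =
     (\<Sum>k\<le>d' + 2. elem_sym_eta d' \<alpha>' (1 - ep') (1 - em') (int k) *
        ceval (left.rpoly (int m + 1 - int k)) (2 * cos \<xi>))"
  unfolding bs_Q_def left.bs_q_eq
proof (rule sum.mono_neutral_left)
  show "{k. real k \<le> 2 * (d_eps d' ep' em' + 1)} \<subseteq> {..d' + 2}"
  proof safe
    fix k assume "real k \<le> 2 * (d_eps d' ep' em' + 1)"
    also have "\<dots> \<le> real (d' + 2)" by (simp add: d_eps_def field_simps)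
    finally show "k \<le> d' + 2" by (simp only: of_nat_le_iff)
  qed
  have "elem_sym_eta d' \<alpha>' (1 - ep') (1 - em') (int k) = 0" if "\<not> real k \<le> 2 * (d_eps d' ep' em' + 1)" for k
  proof -
    have "int k > int d' + 2 - int ep' - int em'"
      using that by (simp add: d_eps_def field_simps)
    then show ?thesis
      using right.ep_em by (auto simp: elem_sym_eta_def elem_sym_above)
  qed
  then show "\<forall>k\<in>{..d' + 2} - {k. real k \<le> 2 * (d_eps d' ep' em' + 1)}.
     elem_sym_eta d' \<alpha>' (1 - ep') (1 - em') (int k) * ceval (left.rpoly (int m + 1 - int k)) (2 * cos \<xi>) = 0"
    by simp
qed simp

text \<open>One half of Q. It equals c c~ (1 - z^{-2}) z^{m+1} with \<open>right.den\<close>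
  cancelled against 1 - z^{-2}, so it can be evaluated at z = 1 and z = -1 whenever the first family
  has no pole there.\<close>

definition H :: "complex \<Rightarrow> complex" where
  "H z = left.num (inverse z) / left.den z * z powi (int m + 1) *
     (right.num (inverse z) * (1 + of_nat (1 - ep') * inverse z) * (1 - of_nat (1 - em') * inverse z))"

lemma bs_Q_H:
  assumes "left.den (exp (\<i> * \<xi>)) \<noteq> 0"
  shows "bs_Q d ep em \<alpha> d' ep' em' \<alpha>' m \<xi> = H (exp (\<i> * \<xi>)) + H (inverse (exp (\<i> * \<xi>)))"
proof -
  define z where "z = exp (\<i> * \<xi>)"
  define \<eta> where "\<eta> = (\<lambda>k. elem_sym_eta d' \<alpha>' (1 - ep') (1 - em') (int k))"
  define M where "M = int m + 1"
  have z: "z \<noteq> 0" "left.den z \<noteq> 0" using assms by (auto simp: z_def)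
  have gen: "(\<Sum>k\<le>d' + 2. \<eta> k * y ^ k) = right.num y * (1 + of_nat (1 - ep') * y) * (1 - of_nat (1 - em') * y)" for y
    unfolding \<eta>_def right.num_def by (rule elem_sym_eta_generating)
  have p: "z powi (M - int k) = z powi M * inverse z ^ k" "z powi - (M - int k) = inverse z powi M * z ^ k" for k
    using z by (simp_all add: power_int_diff power_int_minus power_int_inverse field_simps)
  have "bs_Q d ep em \<alpha> d' ep' em' \<alpha>' m \<xi> = (\<Sum>k\<le>d' + 2. \<eta> k *
      (left.num (inverse z) / left.den z * z powi (M - int k) +
       left.num z / left.den (inverse z) * z powi - (M - int k)))"
    unfolding bs_Q_sum cos_exp_inverse z_def[symmetric] left.rpoly_kernel[OF z] \<eta>_def M_def by simp
  also have "\<dots> = left.num (inverse z) / left.den z * z powi M * (\<Sum>k\<le>d' + 2. \<eta> k * inverse z ^ k) +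
      left.num z / left.den (inverse z) * inverse z powi M * (\<Sum>k\<le>d' + 2. \<eta> k * z ^ k)"
    unfolding p by (simp only: distrib_left sum.distrib sum_distrib_left mult_ac)
  finally show ?thesis
    unfolding gen z_def[symmetric] by (simp add: H_def M_def)
qed

text \<open>Lowering both indices by one multiplies the mixed terms by z / z = 1 and the pure terms
  by z^{-2} or z^2. So the mixed terms drop out and the pure ones acquire the factors 1 - z^{-2} and
  1 - z^2.\<close>

lemma W_generic:
  assumes "z \<noteq> 0" "left.den z \<noteq> 0" "right.den z \<noteq> 0"
  shows "ceval W (z + inverse z) =
    left.num (inverse z) / left.den z * (right.num (inverse z) / right.den z) * z powi (int m + 1) * (1 - inverse z ^ 2) +
    left.num z / left.den (inverse z) * (right.num z / right.den (inverse z)) * z powi (- (int m + 1)) * (1 - z ^ 2)"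
proof -
  define a b where "a = z powi int n0" and "b = z powi int K"
  have nz: "a \<noteq> 0" "b \<noteq> 0" using assms by (auto simp: a_def b_def)
  have p: "z powi (int n0 - 1) = a * inverse z" "z powi (int K - 1) = b * inverse z"
     "z powi (- int n0) = inverse a" "z powi (- int K) = inverse b"
     "z powi (- (int n0 - 1)) = inverse a * z" "z powi (- (int K - 1)) = inverse b * z"
    using assms by (simp_all add: a_def b_def power_int_diff power_int_minus field_simps)
  have "int m + 1 = int n0 + int K" using n0_K by linarith
  then have M: "z powi (int m + 1) = a * b" "z powi (- (int m + 1)) = inverse a * inverse b"
    using assms by (simp_all only: a_def b_def power_int_add power_int_minus inverse_mult_distrib simp_thms)
  have "(A * a + B * a') * (A' * b + B' * b') - (A * (a * w) + B * (a' * z)) * (A' * (b * w) + B' * (b' * z)) =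
     A * A' * (a * b) * (1 - w ^ 2) + B * B' * (a' * b') * (1 - z ^ 2)"
    if "w * z = 1" for A B A' B' a b a' b' w z :: complex
  proof -
    have "(A * (a * w) + B * (a' * z)) * (A' * (b * w) + B' * (b' * z)) =
       A * A' * (a * b) * w ^ 2 + B * B' * (a' * b') * z ^ 2 + A * B' * a * b' * (w * z) + A' * B * a' * b * (w * z)"
      by (simp add: algebra_simps power2_eq_square)
    then show ?thesis unfolding that by (simp add: algebra_simps)
  qed
  note * = this
  show ?thesis
    unfolding W_rpoly ceval_diff ceval_mult left.rpoly_kernel[OF assms(1,2), symmetric]
      right.rpoly_kernel[OF assms(1,3), symmetric] p M a_def[symmetric] b_def[symmetric]
    by (rule *) (use assms in simp)
qed

lemma bs_Q_eq_W: "bs_Q d ep em \<alpha> d' ep' em' \<alpha>' m \<xi> = ceval W (2 * cos \<xi>)"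
proof (rule isCont_eq_everywhere[where f = "\<lambda>\<xi>. bs_Q d ep em \<alpha> d' ep' em' \<alpha>' m \<xi>" and g = "\<lambda>\<xi>. ceval W (2 * cos \<xi>)"])
  show "isCont (\<lambda>\<xi>. bs_Q d ep em \<alpha> d' ep' em' \<alpha>' m \<xi>) \<xi>" "isCont (\<lambda>\<xi>. ceval W (2 * cos \<xi>)) \<xi>"
    unfolding bs_Q_sum by (intro continuous_intros)+
next
  fix w :: complex assume "sin w \<noteq> 0"
  define z where "z = exp (\<i> * w)"
  have zz: "z \<noteq> 0" "z \<noteq> 1" "z \<noteq> - 1"
    using sin_nonzero_imp_exp_ne[OF \<open>sin w \<noteq> 0\<close>] by (auto simp: z_def)
  then have z: "left.den z \<noteq> 0" "right.den z \<noteq> 0"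
    using left.den_nonzero[of z] right.den_nonzero[of z] by blast+
  have "inverse z \<noteq> 0" "inverse z \<noteq> 1" "inverse z \<noteq> - 1"
    using zz by (metis inverse_nonzero_iff_nonzero, metis inverse_1 inverse_inverse_eq,
      metis inverse_1 inverse_minus_eq inverse_inverse_eq)
  then have z': "right.den (inverse z) \<noteq> 0"
    using right.den_nonzero[of "inverse z"] by blast
  have den: "right.den u * ((1 + of_nat (1 - ep') * inverse u) * (1 - of_nat (1 - em') * inverse u)) = 1 - inverse u ^ 2" for u
    using right.ep_em by (auto simp: bs_den_def algebra_simps power2_eq_square)
  have H: "H u = left.num (inverse u) / left.den u * (right.num (inverse u) / right.den u) * u powi (int m + 1) * (1 - inverse u ^ 2)"
    if "right.den u \<noteq> 0" for u
    unfolding H_def den[symmetric] using that by simp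
  have "bs_Q d ep em \<alpha> d' ep' em' \<alpha>' m w = H z + H (inverse z)"
    using bs_Q_H[of w] z by (simp add: z_def)
  also have "\<dots> = ceval W (2 * cos w)"
  proof -
    have "inverse z powi j = z powi (- j)" for j
      by (simp add: power_int_inverse power_int_minus)
    then show ?thesis
      unfolding cos_exp_inverse z_def[symmetric] W_generic[OF zz(1) z] H[OF z(2)] H[OF z']
      by (simp only: inverse_inverse_eq)
  qed
  finally show "bs_Q d ep em \<alpha> d' ep' em' \<alpha>' m w = ceval W (2 * cos w)" .
qed

end

section \<open>The nodes\<close>

text \<open>An antiderivative of the Poisson kernel; for real \<open>a\<close> it is \<xi> - 2 Arg
  (1 + a z). The principal branch of \<open>Ln\<close> is smooth here, because 1 + a z has positive
  real part on the circle.\<close>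

definition poisson_int :: "complex \<Rightarrow> real \<Rightarrow> complex" where
  "poisson_int a \<xi> = of_real \<xi> - \<i> * (Ln (1 + a * cis (- \<xi>)) - Ln (1 + a * cis \<xi>))"

lemma Re_one_plus_pos:
  assumes "cmod a < 1"
  shows "Re (1 + a * cis \<xi>) > 0"
proof -
  have "\<bar>Re (a * cis \<xi>)\<bar> \<le> cmod (a * cis \<xi>)"
    by (rule abs_Re_le_cmod)
  then show ?thesis using assms by (simp add: norm_mult)
qed

lemma one_plus_nonzero: "cmod a < 1 \<Longrightarrow> 1 + a * cis \<xi> \<noteq> 0"
  using Re_one_plus_pos[of a \<xi>] by (metis less_irrefl zero_complex.sel(1))

lemma poisson_u_partial_fractions:
  assumes "cmod a < 1"
  shows "poisson_u a \<xi> = 1 / (1 + a * cis (- \<xi>)) + 1 / (1 + a * cis \<xi>) - 1"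
proof -
  have "1 + a * cis \<xi> \<noteq> 0" "1 + a * cis (- \<xi>) \<noteq> 0"
    using one_plus_nonzero assms by blast+
  moreover have "cis \<xi> * cis (- \<xi>) = 1"
    by (simp add: cis_mult)
  moreover have "2 * complex_of_real (cos \<xi>) = cis \<xi> + cis (- \<xi>)"
    by (simp add: complex_eq_iff)
  moreover have "(1 - a\<^sup>2) / (1 + a * (z + w) + a\<^sup>2) = 1 / (1 + a * w) + 1 / (1 + a * z) - 1"
    if "1 + a * z \<noteq> 0" "1 + a * w \<noteq> 0" "z * w = 1" for z w
  proof -
    have 1: "1 + a * (z + w) + a\<^sup>2 = (1 + a * w) * (1 + a * z)"
    proof -
      have "(1 + a * w) * (1 + a * z) = 1 + a * (z + w) + a\<^sup>2 * (z * w)"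
        by (simp add: algebra_simps power2_eq_square)
      then show ?thesis by (simp add: that)
    qed
    have "1 / (1 + a * w) + 1 / (1 + a * z) - 1 = (1 - a\<^sup>2 * (z * w)) / ((1 + a * w) * (1 + a * z))"
      using that(1,2) by (simp add: divide_simps) (simp add: algebra_simps power2_eq_square)
    then show ?thesis by (simp only: 1 that(3)) simp
  qed
  ultimately show ?thesis
    by (simp add: poisson_u_def mult.assoc mult.left_commute[of 2])
qed

text \<open>v \<mapsto> 1 / (1 + v) maps the unit disc into the half plane Re > 1/2, and the kernel
  is a sum of two such values minus 1. For non-real \<open>a\<close> the kernel itself need not be
  real.\<close>

lemma Re_poisson_u_pos:
  assumes "cmod a < 1"
  shows "Re (poisson_u a \<xi>) > 0"
proof -
  have "Re (1 / (1 + a * cis t)) > 1 / 2" for t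
  proof -
    define v where "v = a * cis t"
    have v: "cmod v < 1" using assms by (simp add: v_def norm_mult)
    then have "(cmod v)\<^sup>2 < 1" by (simp add: power_less_one_iff abs_square_less_1)
    then have "(Re v)\<^sup>2 + (Im v)\<^sup>2 < 1" by (simp add: cmod_power2)
    moreover have pos: "(1 + Re v)\<^sup>2 + (Im v)\<^sup>2 > 0"
      using Re_one_plus_pos[OF assms, of t] by (simp add: v_def add_pos_nonneg)
    ultimately have "(1 + Re v) / ((1 + Re v)\<^sup>2 + (Im v)\<^sup>2) > 1 / 2"
      by (subst less_divide_eq) (simp add: power2_eq_square algebra_simps)
    then show ?thesis by (simp add: v_def[symmetric] Re_divide)
  qed
  from this[of \<xi>] this[of "- \<xi>"] show ?thesis
    by (simp add: poisson_u_partial_fractions[OF assms])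
qed

lemma poisson_int_0 [simp]: "poisson_int a 0 = 0"
  by (simp add: poisson_int_def)

lemma poisson_int_pi: "poisson_int a pi = of_real pi"
  by (simp add: poisson_int_def cis.ctr complex_eq_iff Complex_eq_0)

lemma poisson_int_deriv:
  assumes "cmod a < 1"
  shows "(poisson_int a has_vector_derivative poisson_u a \<xi>) (at \<xi> within A)"
proof -
  have nn: "1 + a * cis t \<notin> \<real>\<^sub>\<le>\<^sub>0" for t
    using Re_one_plus_pos[OF assms, of t] by (auto simp: complex_nonpos_Reals_iff)
  have cis_eq: "cis t = exp (\<i> * of_real t)" for t
    by (simp add: cis_conv_exp)
  define f where "f = (\<lambda>z::complex. z - \<i> * (Ln (1 + a * exp (- (\<i> * z))) - Ln (1 + a * exp (\<i> * z))))"
  have nn': "1 + a * exp (\<i> * of_real \<xi>) \<notin> \<real>\<^sub>\<le>\<^sub>0" "1 + a * exp (- (\<i> * of_real \<xi>)) \<notin> \<real>\<^sub>\<le>\<^sub>0"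
    using nn[of \<xi>] nn[of "- \<xi>"] by (simp_all add: cis_eq)
  then have nz: "1 + a * exp (\<i> * of_real \<xi>) \<noteq> 0" "1 + a * exp (- (\<i> * of_real \<xi>)) \<noteq> 0"
    by force+
  have "(f has_field_derivative (1 - \<i> * (- (\<i> * a * exp (- (\<i> * of_real \<xi>))) / (1 + a * exp (- (\<i> * of_real \<xi>))) -
      \<i> * a * exp (\<i> * of_real \<xi>) / (1 + a * exp (\<i> * of_real \<xi>))))) (at (of_real \<xi>))"
    unfolding f_def using nn' by (auto intro!: derivative_eq_intros simp: divide_inverse mult_ac)
  moreover have "1 - \<i> * (- (\<i> * a * exp (- (\<i> * of_real \<xi>))) / (1 + a * exp (- (\<i> * of_real \<xi>))) -
      \<i> * a * exp (\<i> * of_real \<xi>) / (1 + a * exp (\<i> * of_real \<xi>))) = poisson_u a \<xi>"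
  proof -
    have "1 - \<i> * (- (\<i> * a * v) / (1 + a * v) - \<i> * a * u / (1 + a * u)) = 1 / (1 + a * v) + 1 / (1 + a * u) - 1"
      if "1 + a * u \<noteq> 0" "1 + a * v \<noteq> 0" for u v
    proof -
      have "1 - \<i> * (- (\<i> * a * v) / (1 + a * v) - \<i> * a * u / (1 + a * u)) = 1 - a * v / (1 + a * v) - a * u / (1 + a * u)"
        by (simp add: algebra_simps diff_divide_distrib)
      moreover have "a * w / (1 + a * w) = 1 - 1 / (1 + a * w)" if "1 + a * w \<noteq> 0" for w
        using that by (simp add: field_simps)
      ultimately show ?thesis using that by simp
    qed
    then show ?thesis
      using nz by (simp add: poisson_u_partial_fractions[OF assms] cis_eq)
  qed
  ultimately have "((\<lambda>t. f (of_real t)) has_vector_derivative poisson_u a \<xi>) (at \<xi> within A)"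
    by (intro has_vector_derivative_real_field) auto
  moreover have "(\<lambda>t. f (of_real t)) = poisson_int a"
    by (auto simp: f_def poisson_int_def cis_eq)
  ultimately show ?thesis by simp
qed

lemma LBINT_poisson_u:
  assumes "cmod a < 1"
  shows "(LBINT x=0..ereal \<xi>. poisson_u a x) = poisson_int a \<xi>"
proof -
  have "(LBINT x=ereal 0..ereal \<xi>. poisson_u a x) = poisson_int a \<xi> - poisson_int a 0"
  proof (rule interval_integral_FTC_finite)
    have "1 + a * cis x \<noteq> 0" for x
      using one_plus_nonzero assms by blast
    then show "continuous_on {min 0 \<xi>..max 0 \<xi>} (poisson_u a)"
      unfolding poisson_u_partial_fractions[OF assms, abs_def] by (auto intro!: continuous_intros)
  qed (rule poisson_int_deriv[OF assms])
  then show ?thesis by (simp add: zero_ereal_def)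
qed

text \<open>\<open>exp\<close> undoes \<open>Ln\<close>, so no branch has to be tracked; the form
  without quotients can be multiplied over the parameters.\<close>

lemma exp_poisson_int:
  assumes "cmod a < 1"
  shows "exp (\<i> * poisson_int a \<xi>) * (1 + a * cis \<xi>) = cis \<xi> * (1 + a * cis (- \<xi>))"
proof -
  have nz: "1 + a * cis t \<noteq> 0" for t
    using one_plus_nonzero assms by blast
  have "\<i> * poisson_int a \<xi> = \<i> * of_real \<xi> + Ln (1 + a * cis (- \<xi>)) - Ln (1 + a * cis \<xi>)"
    by (simp add: poisson_int_def algebra_simps)
  then have "exp (\<i> * poisson_int a \<xi>) = cis \<xi> * (1 + a * cis (- \<xi>)) / (1 + a * cis \<xi>)"
    using nz by (simp add: exp_add exp_diff cis_conv_exp[symmetric] del: exp_Ln) (simp add: exp_Ln)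
  then show ?thesis using nz by simp
qed

lemma cnj_poisson_int:
  assumes "cmod a < 1"
  shows "cnj (poisson_int a \<xi>) = poisson_int (cnj a) \<xi>"
proof -
  have "1 + a * cis t \<notin> \<real>\<^sub>\<le>\<^sub>0" for t
    using Re_one_plus_pos[OF assms, of t] by (auto simp: complex_nonpos_Reals_iff)
  then have "cnj (Ln (1 + a * cis t)) = Ln (1 + cnj a * cis (- t))" for t
    by (simp add: cnj_Ln cis_cnj)
  from this[of \<xi>] this[of "- \<xi>"] show ?thesis
    by (simp add: poisson_int_def algebra_simps)
qed

section \<open>The phase contributed by the parameters of one family\<close>

context bs_family
begin

definition S :: "real \<Rightarrow> complex" where
  "S \<xi> = (\<Sum>r = 1..d. poisson_int (\<alpha> r) \<xi>)"

lemma S_real: "S \<xi> = of_real (Re (S \<xi>))"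
proof -
  have "cnj (S \<xi>) = (\<Sum>r = 1..d. poisson_int (cnj (\<alpha> r)) \<xi>)"
    unfolding S_def cnj_sum by (intro sum.cong refl cnj_poisson_int \<alpha>_less_1)
  also have "\<dots> = S \<xi>"
    unfolding S_def by (rule conj_paired_sum[OF paired, of "\<lambda>a. poisson_int a \<xi>"])
  finally have "S \<xi> \<in> \<real>" by (simp add: Reals_cnj_iff)
  then show ?thesis by simp
qed

lemma S_0: "S 0 = 0" and S_pi: "S pi = of_real (real d * pi)"
  by (simp_all add: S_def poisson_int_pi)

lemma LBINT_S: "(\<Sum>r = 1..d. LBINT x=0..ereal \<xi>. poisson_u (\<alpha> r) x) = S \<xi>"
  unfolding S_def by (intro sum.cong refl LBINT_poisson_u \<alpha>_less_1)

lemma Re_S_deriv: "\<exists>y\<ge>0. ((\<lambda>\<xi>. Re (S \<xi>)) has_real_derivative y) (at \<xi>)"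
proof -
  have "(S has_vector_derivative (\<Sum>r = 1..d. poisson_u (\<alpha> r) \<xi>)) (at \<xi>)"
    unfolding S_def by (intro has_vector_derivative_sum poisson_int_deriv \<alpha>_less_1)
  then have "((\<lambda>\<xi>. Re (S \<xi>)) has_vector_derivative Re (\<Sum>r = 1..d. poisson_u (\<alpha> r) \<xi>)) (at \<xi>)"
    by (rule bounded_linear.has_vector_derivative[OF bounded_linear_Re])
  moreover have "Re (\<Sum>r = 1..d. poisson_u (\<alpha> r) \<xi>) \<ge> 0"
    unfolding Re_sum by (intro sum_nonneg less_imp_le Re_poisson_u_pos \<alpha>_less_1)
  ultimately show ?thesis
    by (auto simp: has_real_derivative_iff_has_vector_derivative)
qed

lemma exp_S: "exp (\<i> * S \<xi>) * num (cis \<xi>) = cis \<xi> ^ d * num (cis (- \<xi>))"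
proof -
  have "exp (\<i> * S \<xi>) * num (cis \<xi>) = (\<Prod>r = 1..d. exp (\<i> * poisson_int (\<alpha> r) \<xi>) * (1 + \<alpha> r * cis \<xi>))"
    by (simp add: S_def num_def sum_distrib_left exp_sum prod.distrib)
  also have "\<dots> = (\<Prod>r = 1..d. cis \<xi> * (1 + \<alpha> r * cis (- \<xi>)))"
    by (intro prod.cong refl exp_poisson_int \<alpha>_less_1)
  finally show ?thesis by (simp add: num_def prod.distrib)
qed

end

section \<open>The node equation and the zeros of W\<close>

context bs_pair
begin

definition F :: "real \<Rightarrow> real" where
  "F \<xi> = 2 * (real m - d_eps d ep em - d_eps d' ep' em') * \<xi> + Re (left.S \<xi>) + Re (right.S \<xi>)"

abbreviation "node \<equiv> bs_node d ep em \<alpha> d' ep' em' \<alpha>' m"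

lemma node_eq: "node j = (THE \<xi>. F \<xi> = pi * (2 * real j + real em + real em'))"
proof -
  have "complex_of_real (2 * (real m - d_eps d ep em - d_eps d' ep' em') * \<xi>) + left.S \<xi> + right.S \<xi> = of_real (F \<xi>)" for \<xi>
    by (subst left.S_real, subst right.S_real) (simp add: F_def)
  then show ?thesis
    unfolding bs_node_def left.LBINT_S right.LBINT_S by (simp only: of_real_eq_iff)
qed

text \<open>Doubling clears the halves in d_eps, so e^{i F} involves only integral powers of z; at
  pi the terms -d pi and -d' pi cancel the phases of the two families.\<close>

lemma F_alt:
  "F \<xi> = real (2 * m + ep + em + ep' + em') * \<xi> - real d * \<xi> - real d' * \<xi> + Re (left.S \<xi>) + Re (right.S \<xi>)"
proof -
  have "2 * (real m - d_eps d ep em - d_eps d' ep' em') = real (2 * m + ep + em + ep' + em') - real d - real d'"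
    by (simp add: d_eps_def field_simps)
  then show ?thesis by (simp only: F_def left_diff_distrib)
qed

lemma F_deriv: "\<exists>y>0. (F has_real_derivative y) (at \<xi>)"
proof -
  obtain y y' where y: "y \<ge> 0" "y' \<ge> 0"
    "((\<lambda>\<xi>. Re (left.S \<xi>)) has_real_derivative y) (at \<xi>)" "((\<lambda>\<xi>. Re (right.S \<xi>)) has_real_derivative y') (at \<xi>)"
    using left.Re_S_deriv[of \<xi>] right.Re_S_deriv[of \<xi>] by blast
  have "real m - d_eps d ep em - d_eps d' ep' em' > 0"
    using m_large by linarith
  moreover have "(F has_real_derivative (2 * (real m - d_eps d ep em - d_eps d' ep' em') + y + y')) (at \<xi>)"
    unfolding F_def by (intro DERIV_add y DERIV_cmult_Id)
  ultimately show ?thesis using y by (intro exI[of _ "2 * (real m - d_eps d ep em - d_eps d' ep' em') + y + y'"]) auto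
qed

lemma F_strict_mono: "x < y \<Longrightarrow> F x < F y"
  by (rule DERIV_pos_imp_increasing) (use F_deriv in auto)

lemma F_eq_iff: "F x = F y \<longleftrightarrow> x = y"
  using F_strict_mono[of x y] F_strict_mono[of y x] by (cases x y rule: linorder_cases; simp)+

lemma F_0: "F 0 = 0" and F_pi: "F pi = pi * (2 * real m + real ep + real em + real ep' + real em')"
  by (simp_all add: F_alt left.S_0 right.S_0 left.S_pi right.S_pi algebra_simps)

lemma F_node:
  assumes "j \<le> m"
  shows "F (node j) = pi * (2 * real j + real em + real em')" "0 \<le> node j" "node j \<le> pi"
proof -
  have "continuous_on {0..pi} F"
    using F_deriv by (meson DERIV_isCont continuous_at_imp_continuous_on)
  moreover have "F 0 \<le> pi * (2 * real j + real em + real em')"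
    by (simp add: F_0)
  moreover have "pi * (2 * real j + real em + real em') \<le> F pi"
    unfolding F_pi using assms by (intro mult_left_mono) auto
  ultimately obtain \<xi> where \<xi>: "0 \<le> \<xi>" "\<xi> \<le> pi" "F \<xi> = pi * (2 * real j + real em + real em')"
    using IVT'[of F 0 _ pi] by auto
  have "node j = \<xi>"
    unfolding node_eq \<xi>(3)[symmetric] F_eq_iff by simp
  then show "F (node j) = pi * (2 * real j + real em + real em')" "0 \<le> node j" "node j \<le> pi"
    using \<xi> by auto
qed

lemma inj_on_cos_node: "inj_on (\<lambda>j. cos (node j)) {..m}"
proof (rule inj_onI)
  fix i j assume "i \<in> {..m}" "j \<in> {..m}" "cos (node i) = cos (node j)"
  then have "node i = node j"
    using F_node[of i] F_node[of j] by (auto intro: cos_inj_pi)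
  then have "F (node i) = F (node j)" by simp
  then show "i = j"
    using F_node(1)[of i] F_node(1)[of j] \<open>i \<in> {..m}\<close> \<open>j \<in> {..m}\<close> by simp
qed

lemma exp_F:
  "exp (\<i> * of_real (F \<xi>)) * (left.num (cis \<xi>) * right.num (cis \<xi>)) =
     cis \<xi> ^ (2 * m + ep + em + ep' + em') * (left.num (cis (- \<xi>)) * right.num (cis (- \<xi>)))"
proof -
  \<comment> \<open>The powers with exponents d and d' are kept on the left, so that all exponents
    are natural numbers, and are cancelled at the end.\<close>
  have "exp (\<i> * of_real (F \<xi>)) * cis \<xi> ^ d * cis \<xi> ^ d' =
      cis \<xi> ^ (2 * m + ep + em + ep' + em') * (exp (\<i> * left.S \<xi>) * exp (\<i> * right.S \<xi>))"
  proof -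
    have "\<i> * of_real (F \<xi>) + of_nat d * (\<i> * of_real \<xi>) + of_nat d' * (\<i> * of_real \<xi>) =
        of_nat (2 * m + ep + em + ep' + em') * (\<i> * of_real \<xi>) + \<i> * left.S \<xi> + \<i> * right.S \<xi>"
      by (subst left.S_real, subst right.S_real) (simp add: F_alt algebra_simps)
    then have "exp (\<i> * of_real (F \<xi>) + of_nat d * (\<i> * of_real \<xi>) + of_nat d' * (\<i> * of_real \<xi>)) =
        exp (of_nat (2 * m + ep + em + ep' + em') * (\<i> * of_real \<xi>) + \<i> * left.S \<xi> + \<i> * right.S \<xi>)"
      by (rule arg_cong)
    then show ?thesis
      by (simp only: exp_add exp_of_nat_mult cis_conv_exp mult.assoc)
  qed
  then have "exp (\<i> * of_real (F \<xi>)) * cis \<xi> ^ d * cis \<xi> ^ d' * (left.num (cis \<xi>) * right.num (cis \<xi>)) =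
      cis \<xi> ^ (2 * m + ep + em + ep' + em') *
      ((exp (\<i> * left.S \<xi>) * left.num (cis \<xi>)) * (exp (\<i> * right.S \<xi>) * right.num (cis \<xi>)))"
    by (simp only: mult_ac)
  also have "\<dots> = cis \<xi> ^ (2 * m + ep + em + ep' + em') *
      ((cis \<xi> ^ d * left.num (cis (- \<xi>))) * (cis \<xi> ^ d' * right.num (cis (- \<xi>))))"
    by (simp only: left.exp_S right.exp_S)
  finally have "cis \<xi> ^ d * cis \<xi> ^ d' * (exp (\<i> * of_real (F \<xi>)) * (left.num (cis \<xi>) * right.num (cis \<xi>))) =
      cis \<xi> ^ d * cis \<xi> ^ d' * (cis \<xi> ^ (2 * m + ep + em + ep' + em') * (left.num (cis (- \<xi>)) * right.num (cis (- \<xi>))))"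
    by (simp only: mult_ac)
  moreover have "cis \<xi> ^ d * cis \<xi> ^ d' \<noteq> 0" by simp
  ultimately show ?thesis using mult_left_cancel by blast
qed

lemma W_node:
  assumes "j \<le> m"
  shows "poly W (2 * cos (node j)) = 0"
proof -
  define \<xi> where "\<xi> = node j"
  note F = F_node[OF assms, folded \<xi>_def]
  have QW: "bs_Q d ep em \<alpha> d' ep' em' \<alpha>' m (of_real \<xi>) = of_real (poly W (2 * cos \<xi>))"
    unfolding bs_Q_eq_W ceval_of_real[symmetric] by (simp add: cos_of_real)
  consider "\<xi> = 0" | "\<xi> = pi" | "\<xi> \<in> {0<..<pi}"
    using F by fastforce
  then have "complex_of_real (poly W (2 * cos \<xi>)) = 0"
  proof cases
    case 1
    \<comment> \<open>At \<xi> = 0 the node equation reads 0 = pi (2 j + em + em'). So c has no pole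
      at z = 1, and \<open>H 1\<close> contains the factor 1 - 1.\<close>
    then have "em = 0" "em' = 0" using F(1) by (auto simp: F_0)
    have den: "left.den (exp (\<i> * of_real \<xi>)) \<noteq> 0"
      using 1 \<open>em = 0\<close> left.ep_em by (auto simp: bs_den_def)
    have "H 1 = 0"
      unfolding H_def using \<open>em' = 0\<close> by simp
    then show ?thesis
      using bs_Q_H[OF den] 1 unfolding QW[symmetric] by simp
  next
    case 2
    then have "2 * real m + real ep + real em + real ep' + real em' = 2 * real j + real em + real em'"
      using F(1) by (simp add: F_pi)
    \<comment> \<open>As j \<le> m, both signs vanish: c has no pole at z = -1, and
      \<open>H (- 1)\<close> contains the factor 1 - 1.\<close>
    then have "ep = 0" "ep' = 0" using assms by auto
    have e: "exp (\<i> * of_real \<xi>) = - 1" using 2 by simp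
    have den: "left.den (exp (\<i> * of_real \<xi>)) \<noteq> 0"
      unfolding e using \<open>ep = 0\<close> left.ep_em by (auto simp: bs_den_def)
    have "H (- 1) = 0"
      unfolding H_def using \<open>ep' = 0\<close> by simp
    then show ?thesis
      using bs_Q_H[OF den] unfolding QW[symmetric] e by simp
  next
    case 3
    define z where "z = cis \<xi>"
    define s :: complex where "s = (-1) ^ (em + em')"
    define N where "N = left.num z * right.num z"
    define N' where "N' = left.num (inverse z) * right.num (inverse z)"
    have z: "z \<noteq> 0" "left.den z \<noteq> 0" "right.den z \<noteq> 0" "inverse z = cis (- \<xi>)"
      using left.cis_generic[OF 3] right.cis_generic[OF 3] by (auto simp: z_def)
    have "exp (\<i> * of_real (F \<xi>)) = s"
    proof -
      have "exp (\<i> * of_real (F \<xi>)) = exp (of_nat (2 * j + em + em') * (\<i> * of_real pi))"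
        unfolding F by (simp add: algebra_simps)
      also have "\<dots> = (-1) ^ (2 * j + em + em')"
        unfolding exp_of_nat_mult by simp
      finally show ?thesis by (simp add: s_def power_add power_mult)
    qed
    then have key: "s * N = z ^ (2 * m + ep + em + ep' + em') * N'"
      unfolding N_def N'_def z(4) using exp_F[of \<xi>] by (simp only: z_def)
    have s: "s * s = 1" by (simp add: s_def flip: power_mult_distrib)
    \<comment> \<open>Reflecting the two denominators yields the same sign \<open>s\<close> as e^{i
      F}; as \<open>s * s = 1\<close> the signs cancel, which makes the two terms of W
      opposite.\<close>
    have den: "left.den (inverse z) * right.den (inverse z) = s * z ^ (ep + em + ep' + em') * (left.den z * right.den z)"
      using z(1) by (simp add: bs_den_inverse[OF left.ep_em] bs_den_inverse[OF right.ep_em] s_def power_add power_int_add mult_ac)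
    have "complex_of_real (poly W (2 * cos \<xi>)) = ceval W (z + inverse z)"
    proof -
      have "complex_of_real (2 * cos \<xi>) = z + inverse z"
        by (simp add: z_def complex_eq_iff)
      then show ?thesis by (simp only: ceval_of_real[symmetric])
    qed
    also have "\<dots> = N' / (left.den z * right.den z) * z ^ (m + 1) * (1 - inverse z ^ 2) +
        N / (s * z ^ (ep + em + ep' + em') * (left.den z * right.den z)) * inverse (z ^ (m + 1)) * (1 - z ^ 2)"
    proof -
      have "int m + 1 = int (m + 1)" by simp
      then have "z powi (int m + 1) = z ^ (m + 1)" "z powi (- (int m + 1)) = inverse (z ^ (m + 1))"
        by (simp_all only: power_int_minus power_int_of_nat)
      then show ?thesis
        unfolding W_generic[OF z(1-3)] den[symmetric] N_def N'_def by simp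
    qed
    also have "N / (s * z ^ (ep + em + ep' + em') * (left.den z * right.den z)) =
        z ^ (2 * m) * N' / (left.den z * right.den z)"
    proof -
      have "N = s * z ^ (2 * m + ep + em + ep' + em') * N'"
        using key s by (metis mult.assoc mult_1)
      moreover have "s \<noteq> 0" using s by auto
      ultimately show ?thesis
        using z by (simp add: power_add field_simps)
    qed
    also have "N' / (left.den z * right.den z) * z ^ (m + 1) * (1 - inverse z ^ 2) +
        z ^ (2 * m) * N' / (left.den z * right.den z) * inverse (z ^ (m + 1)) * (1 - z ^ 2) = 0"
    proof -
      have "z ^ (m + 1) * (1 - inverse z ^ 2) + z ^ (2 * m) * inverse (z ^ (m + 1)) * (1 - z ^ 2) = 0"
      proof -
        have "z ^ (2 * m) = z ^ m * z ^ m"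
          by (simp only: mult_2 power_add)
        then show ?thesis
          using z(1) by (simp add: field_simps power2_eq_square)
      qed
      moreover have "A / D * P * Q + Z * A / D * I * R = A / D * (P * Q + Z * I * R)" for A D P Q Z I R :: complex
        by (simp add: divide_inverse distrib_left mult_ac)
      ultimately show ?thesis by (simp only: mult_zero_right)
    qed
    finally show ?thesis .
  qed
  then show ?thesis by (simp only: of_real_eq_0_iff \<xi>_def)
qed

text \<open>The difference of these two monic polynomials has degree at most m but vanishes at the m
  + 1 distinct numbers 2 cos of the nodes.\<close>

lemma W_factor: "W = (\<Prod>j = 0..m. [:- (2 * cos (node j)), 1:])"
proof -
  let ?V = "\<Prod>j = 0..m. [:- (2 * cos (node j)), 1:]"
  have degV: "degree ?V = Suc m"
    by (subst degree_prod_eq_sum_degree) auto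
  have leadV: "Polynomial.coeff ?V (Suc m) = 1"
    using lead_coeff_prod[of "\<lambda>j. [:- (2 * cos (node j)), 1:]" "{0..m}"] degV by simp
  show ?thesis
  proof (rule ccontr)
    assume "W \<noteq> ?V"
    then have nz: "W - ?V \<noteq> 0" by simp
    have "degree (W - ?V) \<noteq> Suc m"
    proof
      assume "degree (W - ?V) = Suc m"
      then have "Polynomial.coeff (W - ?V) (Suc m) \<noteq> 0" using nz by (metis leading_coeff_0_iff)
      then show False by (simp only: coeff_diff leadV lead_coeff_W)
    qed
    moreover have "degree (W - ?V) \<le> Suc m"
      using degree_W degV by (intro degree_diff_le) auto
    ultimately have "degree (W - ?V) < Suc m" by simp
    moreover have "(\<lambda>j. 2 * cos (node j)) ` {..m} \<subseteq> {x. poly (W - ?V) x = 0}"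
    proof safe
      fix j assume "j \<le> m"
      then have "poly ?V (2 * cos (node j)) = 0"
        unfolding poly_prod by (intro prod_zero) auto
      then show "poly (W - ?V) (2 * cos (node j)) = 0"
        using W_node[OF \<open>j \<le> m\<close>] by (simp only: poly_diff)
    qed
    then have "card ((\<lambda>j. 2 * cos (node j)) ` {..m}) \<le> card {x. poly (W - ?V) x = 0}"
      by (intro card_mono poly_roots_finite[OF nz])
    moreover have "card ((\<lambda>j. 2 * cos (node j)) ` {..m}) = Suc m"
      using inj_on_cos_node by (subst card_image) (auto simp: inj_on_def)
    ultimately show False
      using card_poly_roots_bound[OF nz] by linarith
  qed
qed

lemma det_J:
  "Determinant.det (x \<cdot>\<^sub>m 1\<^sub>m (Suc m) - map_mat complex_of_real (bs_J d ep em \<alpha> d' ep' em' \<alpha>' m)) =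
   Determinant.det (x \<cdot>\<^sub>m 1\<^sub>m (Suc m) - map_mat complex_of_real (bs_L d ep em \<alpha> d' ep' em' \<alpha>' m))"
proof -
  define s where "s = (\<lambda>l. sqrt (bs_Delta_m d ep em \<alpha> d' ep' em' \<alpha>' m l))"
  \<comment> \<open>Every branch of \<open>bs_Delta_m\<close> is a squared norm or 1, so the
    diagonal matrices are invertible.\<close>
  have s: "s l \<noteq> 0" for l
    by (simp add: s_def bs_Delta_m_def left.bs_Delta_eq right.bs_Delta_eq)
  let ?L = "bs_L d ep em \<alpha> d' ep' em' \<alpha>' m"
  have L: "?L \<in> carrier_mat (Suc m) (Suc m)"
    by (simp add: bs_L_tridiag)
  let ?A = "x \<cdot>\<^sub>m 1\<^sub>m (Suc m) - map_mat complex_of_real ?L"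
  let ?S = "mat_diag (Suc m) (\<lambda>l. complex_of_real (s l))"
  let ?T = "mat_diag (Suc m) (\<lambda>l. complex_of_real (1 / s l))"
  have A: "?A \<in> carrier_mat (Suc m) (Suc m)" using L by (intro minus_carrier_mat) simp
  have S: "?S \<in> carrier_mat (Suc m) (Suc m)" and T: "?T \<in> carrier_mat (Suc m) (Suc m)"
    by (simp_all add: mat_diag_dim)
  have J: "bs_J d ep em \<alpha> d' ep' em' \<alpha>' m = Matrix.mat (Suc m) (Suc m) (\<lambda>(i, j). s i * ?L $$ (i, j) * (1 / s j))"
  proof -
    have "mat_diag (Suc m) s * ?L = Matrix.mat (Suc m) (Suc m) (\<lambda>(i, j). s i * ?L $$ (i, j))"
      by (rule mat_diag_mult_left[OF L])
    moreover have "Matrix.mat (Suc m) (Suc m) (\<lambda>(i, j). s i * ?L $$ (i, j)) * mat_diag (Suc m) (\<lambda>l. 1 / s l) =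
        Matrix.mat (Suc m) (Suc m) (\<lambda>(i, j). Matrix.mat (Suc m) (Suc m) (\<lambda>(i, j). s i * ?L $$ (i, j)) $$ (i, j) * (1 / s j))"
      by (rule mat_diag_mult_right) simp
    moreover have "sqrt (bs_Delta_m d ep em \<alpha> d' ep' em' \<alpha>' m l) = s l" for l
      by (simp add: s_def)
    ultimately show ?thesis
      unfolding bs_J_def Suc_eq_plus1[symmetric] by (auto intro!: eq_matI)
  qed
  have "?S * ?A * ?T = x \<cdot>\<^sub>m 1\<^sub>m (Suc m) - map_mat complex_of_real (bs_J d ep em \<alpha> d' ep' em' \<alpha>' m)"
  proof -
    have "?S * ?A = Matrix.mat (Suc m) (Suc m) (\<lambda>(i, j). of_real (s i) * ?A $$ (i, j))"
      by (rule mat_diag_mult_left[OF A])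
    moreover have "Matrix.mat (Suc m) (Suc m) (\<lambda>(i, j). of_real (s i) * ?A $$ (i, j)) * ?T =
        Matrix.mat (Suc m) (Suc m) (\<lambda>(i, j). Matrix.mat (Suc m) (Suc m) (\<lambda>(i, j). of_real (s i) * ?A $$ (i, j)) $$ (i, j) * of_real (1 / s j))"
      by (rule mat_diag_mult_right) simp
    ultimately have "?S * ?A * ?T =
        Matrix.mat (Suc m) (Suc m) (\<lambda>(i, j). of_real (s i) * ?A $$ (i, j) * of_real (1 / s j))"
      by (auto intro!: eq_matI)
    also have "\<dots> = x \<cdot>\<^sub>m 1\<^sub>m (Suc m) - map_mat complex_of_real (bs_J d ep em \<alpha> d' ep' em' \<alpha>' m)"
      unfolding J by (rule eq_matI) (use L s in \<open>auto simp: field_simps\<close>)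
    finally show ?thesis .
  qed
  then have "Determinant.det (x \<cdot>\<^sub>m 1\<^sub>m (Suc m) - map_mat complex_of_real (bs_J d ep em \<alpha> d' ep' em' \<alpha>' m)) =
      Determinant.det ?A * (Determinant.det ?S * Determinant.det ?T)"
    using det_mult[OF mult_carrier_mat[OF S A] T] det_mult[OF S A] by (simp only: mult_ac)
  also have "Determinant.det ?S * Determinant.det ?T = Determinant.det (?S * ?T)"
    by (rule det_mult[OF S T, symmetric])
  also have "?S * ?T = 1\<^sub>m (Suc m)"
    using s by (simp add: mat_diag_diag mat_diag_one)
  finally show ?thesis by simp
qed

end

theorem mainTheorem6:
  fixes d d' ep em ep' em' m :: nat and \<alpha> \<alpha>' :: "nat \<Rightarrow> complex"
  assumes "admissible d ep em \<alpha>" and "admissible d' ep' em' \<alpha>'"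
    and "m > 0" and "int m > \<lceil>d_eps d ep em\<rceil> + \<lceil>d_eps d' ep' em'\<rceil>"
  defines "Q \<equiv> bs_Q d ep em \<alpha> d' ep' em' \<alpha>' m"
    and "\<xi>m \<equiv> bs_node d ep em \<alpha> d' ep' em' \<alpha>' m"
    and "L \<equiv> map_mat complex_of_real (bs_L d ep em \<alpha> d' ep' em' \<alpha>' m)"
    and "J \<equiv> map_mat complex_of_real (bs_J d ep em \<alpha> d' ep' em' \<alpha>' m)"
  shows "(\<exists>P :: complex poly. degree P = m + 1 \<and> (\<forall>\<xi>::complex. Q \<xi> = poly P (cos \<xi>)))
    \<and> (\<forall>\<xi>::complex. Q \<xi> = 2 ^ (m + 1) * (\<Prod>j = 0..m. cos \<xi> - complex_of_real (cos (\<xi>m j))))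
    \<and> (\<forall>\<xi>::complex. Determinant.det ((2 * cos \<xi>) \<cdot>\<^sub>m 1\<^sub>m (m + 1) - L) = Q \<xi>)
    \<and> (\<forall>\<xi>::complex. Determinant.det ((2 * cos \<xi>) \<cdot>\<^sub>m 1\<^sub>m (m + 1) - J) = Q \<xi>)"
proof -
  interpret bs_pair d ep em \<alpha> d' ep' em' \<alpha>' m
    by unfold_locales (use assms in auto)
  have Q: "Q \<xi> = ceval W (2 * cos \<xi>)" for \<xi>
    unfolding Q_def by (rule bs_Q_eq_W)
  \<comment> \<open>W is a polynomial in 2 cos \<xi>, hence the rescaling; the same factor 2, taken
    out of m + 1 linear factors, gives the constant 2^(m+1).\<close>
  define P where "P = map_poly complex_of_real W \<circ>\<^sub>p [:0, 2:]"
  have "degree P = m + 1"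
    by (simp add: P_def degree_pcompose degree_W)
  moreover have "Q \<xi> = poly P (cos \<xi>)" for \<xi>
    by (simp add: Q P_def ceval_def poly_pcompose mult.commute)
  moreover have "Q \<xi> = 2 ^ (m + 1) * (\<Prod>j = 0..m. cos \<xi> - complex_of_real (cos (\<xi>m j)))" for \<xi>
  proof -
    have ceval_prod: "ceval (prod f A) x = (\<Prod>i\<in>A. ceval (f i) x)" for f :: "nat \<Rightarrow> real poly" and A x
      by (induction A rule: infinite_finite_induct) auto
    have "Q \<xi> = (\<Prod>j = 0..m. 2 * (cos \<xi> - complex_of_real (cos (\<xi>m j))))"
      unfolding Q W_factor ceval_prod \<xi>m_def by (intro prod.cong) (auto simp: algebra_simps)
    then show ?thesis by (simp only: prod.distrib prod_constant) simp
  qed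
  moreover have "Determinant.det ((2 * cos \<xi>) \<cdot>\<^sub>m 1\<^sub>m (m + 1) - L) = Q \<xi>" for \<xi>
    using det_L[of "2 * cos \<xi>"] by (simp add: L_def Q)
  moreover have "Determinant.det ((2 * cos \<xi>) \<cdot>\<^sub>m 1\<^sub>m (m + 1) - J) = Q \<xi>" for \<xi>
    using det_L[of "2 * cos \<xi>"] det_J[of "2 * cos \<xi>"] by (simp add: J_def Q)
  ultimately show ?thesis by blast
qed

end
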